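(* Let $S\subset\mathbb{R}^2$ be the Sierpinski gasket, $s=\frac{\log 3}{\log 2}$, and let $C^s(S)$ be the centred Hausdorff $s$-dimensional measure of $S$. With $A_k$ and $\mu_k$ the discrete approximations of $S$ and of its invariant measure, and $S_{01}=f_0(f_1(S))$, let $$C_{k}=\min \left\{ (\theta _{\mu _{k}}^{s}(x,d))^{-1}:\ x\in A_{k}\cap S_{01},\ d=|y-x| \text{ with } y\in A_{k},\ \text{and } \frac{\sqrt{3}}{16}\leq d\leq \frac{\sqrt{3}}{8}+2^{1-k}\right\},$$ where $\theta_{\mu_k}^s(x,d)=\dfrac{\mu_k(B(x,d))}{(2d)^s}$. Then, for every integer $k\geq 4$, $$C_{k}^{\inf }\leq C^{s}(S)\leq C_{k}^{\sup }$$ holds, where $$C_{k}^{\inf }=K_{k}C_{k},\qquad K_{k}=\left( 1+\frac{2^{5-k}}{\sqrt{3}}\right) ^{-s},\qquad C_{k}^{\sup }=\frac{(2d_{k})^{s}}{\mu_{k}(B(x_{k},d_{k}-2^{-k}))},$$ and $B(x_{k},d_{k})$ is a ball attaining the minimum in the definition of $C_k$ (that is, $(x_k,d_k)$ is an admissible pair with $(\theta_{\mu_k}^s(x_k,d_k))^{-1}=C_k$).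
   Context: Let $M=\{0,1,2\}$ and let $f_i:\mathbb{R}^2\to\mathbb{R}^2$, $f_i(x)=\frac12 x+v_i$, $i\in M$, with $v_0=(0,0)$, $v_1=(\frac12,0)$, $v_2=\frac14(1,\sqrt3)$. The Sierpinski gasket $S$ is the unique non-empty compact set with $S=f_0(S)\cup f_1(S)\cup f_2(S)$. For a word $i=i_1\dots i_k\in M^k$, $f_i:=f_{i_1}\circ\dots\circ f_{i_k}$ and $S_i:=f_i(S)$ (for the empty word, $f_i$ is the identity). $z_i=2v_i$ is the fixed point of $f_i$, $i\in M$. Discrete approximations: $A_1:=\{z_0,z_1,z_2\}$ and $A_k:=F^{k-1}(A_1)$ for $k\ge2$, where $F(A)=f_0(A)\cup f_1(A)\cup f_2(A)$; and $$\mu_k:=\frac1{3^k}\sum_{i\in M^{k-1}}\left(\delta_{f_i(z_0)}+\delta_{f_i(z_1)}+\delta_{f_i(z_2)}\right),$$ where $\delta_x$ is the Dirac probability measure at $x$; equivalently $\mu_k=\frac{1}{3^k}(\delta_{z_0}+\delta_{z_1}+\delta_{z_2})+\frac{2}{3^k}\sum_{x\in A_k\setminus A_1}\delta_x$. $B(x,d)$ is the closed Euclidean ball with centre $x$ and radius $d$. Centred Hausdorff measure: for $A\subset\mathbb{R}^n$ put $$C_0^s(A)=\lim_{\delta\to0}\inf\Big\{\sum_{i=1}^\infty(2d_i)^s:\ 2d_i\le\delta,\ i=1,2,\dots\Big\},$$ the infimum being over all countable coverings $\{B(x_i,d_i)\}$ of $A$ by closed balls with centres $x_i\in A$ (with $C_0^s(\varnothing)=0$),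 and $$C^s(A)=\sup\{C_0^s(F):F\subset A,\ F\text{ closed}\}.$$ *)

theory Defs
  imports "HOL-Probability.Probability"
begin

section \<open>The Sierpinski gasket\<close>

definition v :: "nat \<Rightarrow> real^2" where
  "v i = [vector [0, 0], vector [1/2, 0], (1/4) *\<^sub>R vector [1, sqrt 3]] ! i"

definition f :: "nat \<Rightarrow> real^2 \<Rightarrow> real^2" where
  "f i x = (1/2) *\<^sub>R x + v i"

definition z :: "nat \<Rightarrow> real^2" where
  "z i = 2 *\<^sub>R v i"

definition F :: "(real^2) set \<Rightarrow> (real^2) set" where
  "F X = f 0 ` X \<union> f 1 ` X \<union> f 2 ` X"

definition words :: "nat \<Rightarrow> nat list set" where
  "words n = {w. length w = n \<and> set w \<subseteq> {0, 1, 2}}"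

definition fw :: "nat list \<Rightarrow> real^2 \<Rightarrow> real^2" where
  "fw w = foldr (\<lambda>i g. f i \<circ> g) w id"

definition gasket :: "(real^2) set" where
  "gasket = (THE X. compact X \<and> X \<noteq> {} \<and> X = F X)"

definition cell :: "nat list \<Rightarrow> (real^2) set" where
  "cell w = fw w ` gasket"

section \<open>Discrete approximations\<close>

text \<open>The definitions of this section are meant for levels \<open>k \<ge> 1\<close>.\<close>

definition approx :: "nat \<Rightarrow> (real^2) set" where
  "approx k = (F ^^ (k - 1)) {z 0, z 1, z 2}"

text \<open>\<open>return borel x\<close> is the Dirac measure at \<open>x\<close>.\<close>

definition mu :: "nat \<Rightarrow> (real^2) measure" where
  "mu k = measure_of UNIV (sets borel)
     (\<lambda>X. ennreal (1 / 3 ^ k) * (\<Sum>w\<in>words (k - 1).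
        emeasure (return borel (fw w (z 0))) X
        + emeasure (return borel (fw w (z 1))) X
        + emeasure (return borel (fw w (z 2))) X))"

definition theta :: "'a::metric_space measure \<Rightarrow> real \<Rightarrow> 'a \<Rightarrow> real \<Rightarrow> real" where
  "theta m s x d = measure m (cball x d) / (2 * d) powr s"

section \<open>The centred Hausdorff measure\<close>

text \<open>Only proper balls (of positive radius) are used for coverings; for \<open>s > 0\<close> allowing radius
  zero, or finite coverings, would not change the infimum.\<close>

definition centred_coverings ::
  "real \<Rightarrow> 'a::metric_space set \<Rightarrow> ((nat \<Rightarrow> 'a) \<times> (nat \<Rightarrow> real)) set" where
  "centred_coverings \<delta> X = {(x, d).
     (\<forall>i. x i \<in> X \<and> 0 < d i \<and> 2 * d i \<le> \<delta>) \<and> X \<subseteq> (\<Union>i. cball (x i) (d i))}"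

definition centred_inf :: "real \<Rightarrow> real \<Rightarrow> 'a::metric_space set \<Rightarrow> ennreal" where
  "centred_inf s \<delta> X =
     (INF (x, d) \<in> centred_coverings \<delta> X. \<Sum>i. ennreal ((2 * d i) powr s))"

definition centred_premeasure :: "real \<Rightarrow> 'a::metric_space set \<Rightarrow> ennreal" where
  "centred_premeasure s X =
     (if X = {} then 0 else Lim (at_right 0) (\<lambda>\<delta>. centred_inf s \<delta> X))"

definition centred_hausdorff :: "real \<Rightarrow> 'a::metric_space set \<Rightarrow> ennreal" where
  "centred_hausdorff s X = (SUP Y \<in> {Y. Y \<subseteq> X \<and> closed Y}. centred_premeasure s Y)"

section \<open>The bounds\<close>

definition sdim :: real where
  "sdim = ln 3 / ln 2"

definition admissible :: "nat \<Rightarrow> ((real^2) \<times> real) set" where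
  "admissible k = {(x, d). x \<in> approx k \<inter> cell [0, 1] \<and> (\<exists>y \<in> approx k. d = norm (y - x))
     \<and> sqrt 3 / 16 \<le> d \<and> d \<le> sqrt 3 / 8 + 2 powi (1 - int k)}"

definition C :: "nat \<Rightarrow> real" where
  "C k = Min ((\<lambda>(x, d). inverse (theta (mu k) sdim x d)) ` admissible k)"

definition K :: "nat \<Rightarrow> real" where
  "K k = (1 + 2 powi (5 - int k) / sqrt 3) powr (- sdim)"

definition C_inf :: "nat \<Rightarrow> real" where
  "C_inf k = K k * C k"

text \<open>Here \<open>(x, d)\<close> is the pair \<open>(x\<^sub>k, d\<^sub>k)\<close>.\<close>

definition C_sup :: "nat \<Rightarrow> real^2 \<Rightarrow> real \<Rightarrow> real" where
  "C_sup k x d = (2 * d) powr sdim / measure (mu k) (cball x (d - 2 powi (- int k)))"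

section \<open>The definitions are meaningful\<close>

lemma norm_v_le: "i \<in> {0, 1, 2} \<Longrightarrow> norm (v i) \<le> 1/2"
  by (auto simp: v_def norm_vec_def L2_set_def sum_2 vector_2 power2_eq_square field_simps
      numeral_2_eq_2[symmetric] real_sqrt_divide)

lemma F_UN: "F X = (\<Union>i\<in>{0, 1, 2}. f i ` X)"
  by (auto simp: F_def)

lemma continuous_on_f: "continuous_on X (f i)"
  unfolding f_def by (intro continuous_intros)

lemma compact_F: "compact X \<Longrightarrow> compact (F X)"
  unfolding F_def by (intro compact_Un compact_continuous_image continuous_on_f)

lemma F_mono: "X \<subseteq> Y \<Longrightarrow> F X \<subseteq> F Y"
  by (auto simp: F_def)

lemma attractor_subset:
  assumes X: "compact X" "X \<noteq> {}" "X = F X" and Y: "compact Y" "Y \<noteq> {}" "Y = F Y"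
  shows "X \<subseteq> Y"
proof -
  obtain a where a: "a \<in> X" and max: "\<And>x. x \<in> X \<Longrightarrow> infdist x Y \<le> infdist a Y"
    using continuous_attains_sup[OF X(1,2), of "\<lambda>x. infdist x Y"]
      continuous_on_infdist[OF continuous_on_id] by blast
  from a X(3) obtain i b where i: "i \<in> {0, 1, 2}" and b: "b \<in> X" "a = f i b"
    unfolding F_UN by blast
  obtain y where y: "y \<in> Y" "infdist b Y = dist b y"
    using infdist_attains_inf[OF compact_imp_closed[OF Y(1)] Y(2)] by metis
  have "f i y \<in> Y" using y(1) i Y(3) unfolding F_UN by blast
  then have "infdist a Y \<le> dist a (f i y)" by (rule infdist_le)
  also have "\<dots> = dist b y / 2"
    unfolding b(2) f_def dist_norm
    by (simp add: scaleR_diff_right[symmetric])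
  also have "\<dots> \<le> infdist a Y / 2" using max[OF b(1)] y(2) by simp
  finally have "infdist a Y = 0" using infdist_nonneg[of a Y] by linarith
  then have "infdist x Y = 0" if "x \<in> X" for x
    using max[OF that] infdist_nonneg[of x Y] by linarith
  then show ?thesis
    using in_closed_iff_infdist_zero[OF compact_imp_closed[OF Y(1)] Y(2)] by blast
qed

lemma attractor_exists: "\<exists>X. compact X \<and> X \<noteq> {} \<and> X = F X"
proof -
  define B where "B n = (F ^^ n) (cball 0 1)" for n
  have f_ball: "f i x \<in> cball 0 1" if "i \<in> {0, 1, 2}" "x \<in> cball 0 1" for i x
    using norm_v_le[OF that(1)] that(2) norm_triangle_ineq[of "(1/2) *\<^sub>R x" "v i"]
    by (simp add: f_def)
  have B_Suc: "B (Suc n) = F (B n)" for n by (simp add: B_def)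
  have B_comp: "compact (B n)" for n
    by (induction n) (auto simp: B_Suc compact_F, simp add: B_def)
  have B_ne: "B n \<noteq> {}" for n
    by (induction n) (auto simp: B_Suc F_def, simp add: B_def)
  have dec: "B (Suc n) \<subseteq> B n" for n
  proof (induction n)
    case 0
    show ?case using f_ball by (auto simp: B_def F_UN)
  next
    case (Suc n)
    then show ?case by (metis B_Suc F_mono)
  qed
  have anti: "B n \<subseteq> B m" if "m \<le> n" for m n
    using lift_Suc_antimono_le[of B, OF dec that] .
  define X where "X = (\<Inter>n. B n)"
  have "compact X" unfolding X_def using B_comp by (intro compact_Inter) auto
  moreover have "X \<noteq> {}" unfolding X_def using compact_nest[OF B_comp B_ne anti] .
  moreover have "X = F X"
  proof
    show "F X \<subseteq> X"
    proof
      fix y assume y: "y \<in> F X"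
      have "y \<in> B n" for n
        using F_mono[of X "B n"] y dec[of n] unfolding B_Suc by (auto simp: X_def)
      then show "y \<in> X" by (simp add: X_def)
    qed
    show "X \<subseteq> F X"
    proof
      fix y assume y: "y \<in> X"
      define g where "g i = 2 *\<^sub>R (y - v i)" for i
      have fg: "f i (g i) = y" for i by (simp add: f_def g_def)
      have inj: "x = g i" if "f i x = y" for x i using that by (auto simp: f_def g_def)
      show "y \<in> F X"
      proof (rule ccontr)
        assume no: "y \<notin> F X"
        have "\<exists>n. g i \<notin> B n" if "i \<in> {0, 1, 2}" for i
        proof -
          have "g i \<notin> X" using no fg[of i] that unfolding F_UN by (metis UN_I image_eqI)
          then show ?thesis by (simp add: X_def)
        qed
        then obtain n where n: "\<And>i. i \<in> {0, 1, 2} \<Longrightarrow> g i \<notin> B (n i)" by metis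
        define m where "m = n 0 + n 1 + n 2"
        have "y \<in> F (B m)" using y B_Suc[of m] by (auto simp: X_def)
        then obtain i x where i: "i \<in> {0, 1, 2}" and x: "x \<in> B m" "f i x = y"
          unfolding F_UN by blast
        have "n i \<le> m" using i by (auto simp: m_def)
        then have "g i \<in> B (n i)" using inj[OF x(2)] x(1) anti by blast
        with n[OF i] show False by contradiction
      qed
    qed
  qed
  ultimately show ?thesis by blast
qed

lemma gasket_unique_existence: "\<exists>!X. compact X \<and> X \<noteq> {} \<and> X = F X"
  using attractor_exists attractor_subset by (intro ex_ex1I) (assumption, metis subset_antisym)

lemma gasket_props: "compact gasket" "gasket \<noteq> {}" "gasket = F gasket"
  using theI'[OF gasket_unique_existence] unfolding gasket_def[symmetric] by auto

lemma sets_mu [simp]: "sets (mu k) = sets borel"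
  unfolding mu_def by (simp add: sets.sigma_sets_eq[of borel, simplified])

lemma finite_words: "finite (words n)"
  using finite_lists_length_eq[of "{0, 1, 2::nat}" n] by (simp add: words_def conj_commute)

lemma emeasure_mu:
  assumes X: "X \<in> sets borel"
  shows "emeasure (mu k) X = ennreal (1 / 3 ^ k) *
    (\<Sum>w\<in>words (k - 1). \<Sum>j\<in>{0, 1, 2}. indicator X (fw w (z j)))"
proof -
  let ?m = "\<lambda>X. ennreal (1 / 3 ^ k) * (\<Sum>w\<in>words (k - 1).
        emeasure (return borel (fw w (z 0))) X
        + emeasure (return borel (fw w (z 1))) X
        + emeasure (return borel (fw w (z 2))) X)"
  have "emeasure (mu k) X = ?m X"
  proof (rule emeasure_measure_of[OF mu_def])
    show "countably_additive (sets (mu k)) ?m"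
    proof (rule countably_additiveI)
      fix A :: "nat \<Rightarrow> (real^2) set"
      assume A: "range A \<subseteq> sets (mu k)" "disjoint_family A"
      have *: "(\<Sum>i. emeasure (return borel x) (A i)) = emeasure (return borel x) (\<Union>i. A i)" for x
        using A by (intro suminf_emeasure) auto
      show "(\<Sum>i. ?m (A i)) = ?m (\<Union>i. A i)"
        by (simp add: ennreal_suminf_cmult suminf_sum[OF summableI] suminf_add[symmetric] * summableI)
    qed
  qed (use X in \<open>auto simp: positive_def\<close>)
  also have "\<dots> = ennreal (1 / 3 ^ k) *
    (\<Sum>w\<in>words (k - 1). \<Sum>j\<in>{0, 1, 2}. indicator X (fw w (z j)))"
    using X by (simp add: add.assoc)
  finally show ?thesis .
qed

lemma centred_premeasure_eq_SUP:
  assumes "X \<noteq> {}"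
  shows "centred_premeasure s X = (SUP \<delta>\<in>{0<..}. centred_inf s \<delta> X)"
proof -
  have anti: "centred_inf s \<epsilon> X \<le> centred_inf s \<delta> X" if "\<delta> \<le> \<epsilon>" for \<delta> \<epsilon>
    unfolding centred_inf_def
    by (rule INF_superset_mono) (use that in \<open>auto simp: centred_coverings_def intro: order_trans\<close>)
  have "((\<lambda>\<delta>. centred_inf s \<delta> X) \<longlongrightarrow> (SUP \<delta>\<in>{0<..}. centred_inf s \<delta> X)) (at_right 0)"
  proof (rule order_tendstoI)
    fix a assume "a < (SUP \<delta>\<in>{0<..}. centred_inf s \<delta> X)"
    then obtain \<epsilon> where \<epsilon>: "\<epsilon> > 0" "a < centred_inf s \<epsilon> X" by (auto simp: less_SUP_iff)
    have "\<forall>\<^sub>F \<delta> in at_right 0. \<delta> < \<epsilon>" using \<epsilon>(1) by (auto simp: eventually_at_right)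
    then show "\<forall>\<^sub>F \<delta> in at_right 0. a < centred_inf s \<delta> X"
      by eventually_elim (use \<epsilon>(2) anti in \<open>meson less_imp_le less_le_trans\<close>)
  next
    fix a assume a: "(SUP \<delta>\<in>{0<..}. centred_inf s \<delta> X) < a"
    have "\<forall>\<^sub>F \<delta> in at_right (0::real). 0 < \<delta>" by (rule eventually_at_right_less)
    then show "\<forall>\<^sub>F \<delta> in at_right 0. centred_inf s \<delta> X < a"
      by eventually_elim (use a in \<open>meson SUP_upper greaterThan_iff le_less_trans\<close>)
  qed
  then show ?thesis using assms unfolding centred_premeasure_def
    by (simp add: tendsto_Lim)
qed

lemma finite_approx: "finite (approx k)"
proof -
  have "finite ((F ^^ n) {z 0, z 1, z 2})" for n
    by (induction n) (auto simp: F_def)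
  then show ?thesis by (simp add: approx_def)
qed

lemma finite_admissible: "finite (admissible k)"
proof (rule finite_subset)
  show "admissible k \<subseteq> (\<lambda>(x, y). (x, norm (y - x))) ` (approx k \<times> approx k)"
    by (auto simp: admissible_def)
qed (use finite_approx in blast)

lemma zero_in_gasket: "0 \<in> gasket"
proof -
  obtain g where g: "g \<in> gasket" using gasket_props(2) by blast
  have v0: "v 0 = 0" by (simp add: v_def vec_eq_iff forall_2)
  have "(1/2) ^ n *\<^sub>R g \<in> gasket" for n :: nat
  proof (induction n)
    case (Suc n)
    then have "f 0 ((1/2) ^ n *\<^sub>R g) \<in> F gasket" by (auto simp: F_def)
    then show ?case using gasket_props(3) by (simp add: f_def v0)
  qed (use g in simp)
  moreover have "(\<lambda>n. (1/2) ^ n *\<^sub>R g) \<longlonglongrightarrow> 0 *\<^sub>R g"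
    by (intro tendsto_intros LIMSEQ_power_zero) simp
  ultimately show ?thesis
    using closed_sequentially[OF compact_imp_closed[OF gasket_props(1)]] by fastforce
qed

lemma admissible_nonempty:
  assumes "k \<ge> 4"
  shows "admissible k \<noteq> {}"
proof -
  have v0: "v 0 = 0" by (simp add: v_def vec_eq_iff forall_2)
  have fz: "f i (z i) = z i" for i by (simp add: f_def z_def scaleR_2)
  define P where "P n = (F ^^ n) {z 0, z 1, z 2}" for n
  have PS: "P (Suc n) = F (P n)" for n by (simp add: P_def)
  have "P n \<subseteq> P (Suc n)" for n
  proof (induction n)
    case 0
    have "z i \<in> F {z 0, z 1, z 2}" if "i \<in> {0, 1, 2}" for i
      unfolding F_UN using that fz[of i] by (metis UN_I image_eqI insertCI insertE singletonD)
    then show ?case by (simp add: P_def)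
  qed (metis PS F_mono)
  then have mono: "P m \<subseteq> P n" if "m \<le> n" for m n
    using lift_Suc_mono_le[of P] that by blast
  have sub: "P 3 \<subseteq> approx k"
    using mono[of 3 "k - 1"] assms by (simp add: P_def approx_def)
  define x y where "x = f 0 (f 1 (f 0 (z 0)))" and "y = f 0 (f 1 (f 1 (z 0)))"
  have "x \<in> P 3" "y \<in> P 3"
    by (auto simp: x_def y_def P_def F_def numeral_3_eq_3)
  then have xy: "x \<in> approx k" "y \<in> approx k" using sub by auto
  have z0: "z 0 = 0" by (simp add: z_def v0)
  have "x \<in> cell [0, 1]"
    using zero_in_gasket fz[of 0] by (auto simp: x_def cell_def fw_def z0)
  have "y - x = (1/8) *\<^sub>R vector [1, 0]"
    by (simp add: x_def y_def f_def v0 z0 v_def vec_eq_iff forall_2 vector_2)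
  moreover have "norm (vector [1, 0] :: real^2) = 1"
    by (simp add: norm_vec_def L2_set_def sum_2 vector_2)
  ultimately have n: "norm (y - x) = 1/8" by simp
  have "sqrt 3 \<le> 2" "1 \<le> sqrt 3" by (auto intro: real_le_lsqrt)
  moreover have "0 \<le> (2::real) powi (1 - int k)" by simp
  ultimately have "sqrt 3 / 16 \<le> 1/8" "1/8 \<le> sqrt 3 / 8 + 2 powi (1 - int k)"
    by linarith+
  moreover have "\<exists>y \<in> approx k. 1/8 = norm (y - x)" using xy(2) n by metis
  ultimately have "(x, 1/8) \<in> admissible k"
    using xy \<open>x \<in> cell [0, 1]\<close> unfolding admissible_def by blast
  then show ?thesis by blast
qed

lemma C_attained:
  assumes "k \<ge> 4"
  shows "\<exists>(x, d) \<in> admissible k. inverse (theta (mu k) sdim x d) = C k"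
proof -
  have "C k \<in> (\<lambda>(x, d). inverse (theta (mu k) sdim x d)) ` admissible k"
    unfolding C_def using finite_admissible admissible_nonempty[OF assms] by (intro Min_in) auto
  then show ?thesis by force
qed

end

theory Submission
  imports Defs
begin

text \<open>
  The invariant measure is replaced by the proportion \<open>content n X\<close> of level \<open>n\<close> cells meeting \<open>X\<close>,
  which is finitely subadditive, decreasing in \<open>n\<close> and self-similar.

  Lower bound: a ball centred in the gasket is carried by \<open>f 0 \<circ> f 1\<close> to a ball centred in \<open>S\<^sub>0\<^sub>1\<close>
  without loss of density. A ball of radius below \<open>sqrt 3 / 16\<close> centred in \<open>S\<^sub>0\<^sub>1\<close> sees only the two
  cells at one junction point, so it can be doubled about that point; after a symmetry of the
  triangle its centre is again in \<open>S\<^sub>0\<^sub>1\<close>. Hence only radii in \<open>[sqrt 3 / 16, sqrt 3 / 8)\<close> matter, and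
  such a ball is compared with the \<open>mu k\<close>-measure of a slightly larger ball about a nearby corner.
  As the corners form a graph connected by steps \<open>2\<^sup>1\<^sup>-\<^sup>k\<close>, the enlarged radius can be taken admissible.

  Upper bound: fill the gasket greedily with scaled copies of one ball, which leaves a fraction
  \<open>1 - a\<close> of the cells in each round. For a closed subset \<open>Y\<close> the centres can be moved into \<open>Y\<close>
  in almost all cells, because \<open>content n Y\<close> converges.
\<close>

section \<open>The similarity dimension, the maps \<open>f i\<close> and the position of the
  gasket\<close>

lemma sdim_pos: "0 < sdim"
  by (simp add: sdim_def)

lemma two_powr_sdim: "2 powr sdim = 3"
  by (simp add: sdim_def powr_def)

lemma power_half_powr_sdim: "((1/2) ^ n) powr sdim = 1 / 3 ^ n"
proof -
  have "((1/2) ^ n) powr sdim = ((1/2::real) powr sdim) ^ n"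
    by (induction n) (simp_all add: powr_mult powr_divide)
  then show ?thesis by (simp add: powr_divide two_powr_sdim power_divide)
qed

lemma f_eq_midpoint: "f i x = (1/2) *\<^sub>R x + (1/2) *\<^sub>R z i"
  by (simp add: f_def z_def)

lemma z_components:
  "z 0 $ 1 = 0" "z 0 $ 2 = 0" "z 1 $ 1 = 1" "z 1 $ 2 = 0" "z 2 $ 1 = 1/2" "z 2 $ 2 = sqrt 3 / 2"
  "z (Suc 0) $ 1 = 1" "z (Suc 0) $ 2 = 0"
  by (simp_all add: z_def v_def vector_2)

lemma f_component: "f i x $ j = x $ j / 2 + z i $ j / 2"
  by (simp add: f_eq_midpoint)

lemma f_z [simp]: "f i (z i) = z i"
  by (simp add: f_def z_def scaleR_2)

lemma dist_f: "dist (f i x) (f i y) = dist x y / 2"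
  by (simp add: f_def dist_norm scaleR_diff_right[symmetric])

lemma f_vimage_cball: "f i -` cball (f i y) r = cball y (2 * r)"
  by (auto simp: dist_f)

lemma f_in_gasket: "i \<in> {0, 1, 2} \<Longrightarrow> x \<in> gasket \<Longrightarrow> f i x \<in> gasket"
  using gasket_props(3) unfolding F_UN by blast

lemma gasketE:
  assumes "x \<in> gasket"
  obtains i y where "i \<in> {0, 1, 2}" "y \<in> gasket" "x = f i y"
  using assms gasket_props(3) unfolding F_UN by blast

text \<open>The distance to \<open>Y\<close> attains its maximum over the gasket at some
  \<open>f i b\<close>. Since \<open>f i\<close> halves distances and maps \<open>Y\<close> into
  itself, this maximum is at most half of itself, hence zero.\<close>

lemma gasket_subset_closed_invariant:
  assumes Y: "closed Y" "Y \<noteq> {}" and inv: "\<And>i y. i \<in> {0, 1, 2} \<Longrightarrow> y \<in> Y \<Longrightarrow> f i y \<in> Y"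
  shows "gasket \<subseteq> Y"
proof -
  obtain a where a: "a \<in> gasket" and max: "\<And>x. x \<in> gasket \<Longrightarrow> infdist x Y \<le> infdist a Y"
    using continuous_attains_sup[OF gasket_props(1,2), of "\<lambda>x. infdist x Y"]
      continuous_on_infdist[OF continuous_on_id] by blast
  obtain i b where i: "i \<in> {0, 1, 2}" and b: "b \<in> gasket" "a = f i b"
    using gasketE[OF a] by metis
  obtain y where y: "y \<in> Y" "infdist b Y = dist b y"
    using infdist_attains_inf[OF Y] by metis
  have "infdist a Y \<le> dist a (f i y)" using inv[OF i y(1)] by (rule infdist_le)
  also have "\<dots> \<le> infdist a Y / 2" using max[OF b(1)] y(2) by (simp add: b(2) dist_f)
  finally have "infdist a Y = 0" using infdist_nonneg[of a Y] by linarith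
  then have "infdist x Y = 0" if "x \<in> gasket" for x
    using max[OF that] infdist_nonneg[of x Y] by linarith
  then show ?thesis using in_closed_iff_infdist_zero[OF Y] by blast
qed

text \<open>\<open>f i y\<close> is the midpoint of \<open>y\<close> and \<open>z i\<close>, so a
  convex set containing the three vertices is invariant.\<close>

lemma gasket_subset_closed_convex:
  assumes "closed Y" "convex Y" "z 0 \<in> Y" "z 1 \<in> Y" "z 2 \<in> Y"
  shows "gasket \<subseteq> Y"
proof (rule gasket_subset_closed_invariant)
  fix i :: nat and y assume "i \<in> {0, 1, 2}" "y \<in> Y"
  then have "z i \<in> Y" using assms by auto
  then show "f i y \<in> Y"
    unfolding f_eq_midpoint using \<open>y \<in> Y\<close> by (intro convexD[OF assms(2)]) auto
qed (use assms in auto)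

text \<open>The conditions on \<open>c\<close> say that the three vertices lie in the half-plane,
  which is closed and convex.\<close>

lemma gasket_halfplane:
  assumes "x \<in> gasket" "0 \<le> c" "a \<le> c" "a / 2 + b * sqrt 3 / 2 \<le> c"
  shows "a * x $ 1 + b * x $ 2 \<le> c"
proof -
  have "gasket \<subseteq> {x. a * x $ 1 + b * x $ 2 \<le> c}"
  proof (rule gasket_subset_closed_convex)
    show "closed {x::real^2. a * x $ 1 + b * x $ 2 \<le> c}"
      by (intro closed_Collect_le continuous_intros)
    show "convex {x::real^2. a * x $ 1 + b * x $ 2 \<le> c}"
    proof (rule convexI, simp)
      fix x y :: "real^2" and u w :: real
      assume *: "a * x $ 1 + b * x $ 2 \<le> c" "a * y $ 1 + b * y $ 2 \<le> c" "0 \<le> u" "0 \<le> w" "u + w = 1"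
      have "u * (a * x $ 1 + b * x $ 2) + w * (a * y $ 1 + b * y $ 2) \<le> u * c + w * c"
        using * by (intro add_mono mult_left_mono) auto
      also have "\<dots> = c" using *(5) by (metis distrib_right mult_1)
      finally show "a * (u * x $ 1 + w * y $ 1) + b * (u * x $ 2 + w * y $ 2) \<le> c"
        by (simp add: algebra_simps)
    qed
  qed (use assms in \<open>auto simp: z_components\<close>)
  with assms(1) show ?thesis by blast
qed

lemma z_in_gasket:
  assumes "i \<in> {0, 1, 2}"
  shows "z i \<in> gasket"
proof -
  obtain g where g: "g \<in> gasket" using gasket_props(2) by blast
  define u where "u n = (f i ^^ n) g" for n
  have "u n \<in> gasket" for n
    by (induction n) (use g f_in_gasket assms in \<open>auto simp: u_def\<close>)
  \<comment> \<open>Iterating \<open>f i\<close> contracts any starting point towards the fixed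
    point \<open>z i\<close>; the closed form exhibits the limit.\<close>
  moreover have eq: "u n = z i + (1/2) ^ n *\<^sub>R (g - z i)" for n
  proof (induction n)
    case (Suc n)
    then have "u (Suc n) = f i (z i + (1/2) ^ n *\<^sub>R (g - z i))" by (simp add: u_def)
    then show ?case by (simp only:)
      (simp add: vec_eq_iff f_component algebra_simps add_divide_distrib diff_divide_distrib)
  qed (simp add: u_def)
  have "u \<longlonglongrightarrow> z i + 0 *\<^sub>R (g - z i)"
    unfolding eq by (intro tendsto_intros LIMSEQ_power_zero) simp
  then have "u \<longlonglongrightarrow> z i" by simp
  ultimately show ?thesis
    using closed_sequentially[OF compact_imp_closed[OF gasket_props(1)]] by blast
qed

lemma dist_real2: "dist x y = sqrt ((x $ 1 - y $ 1)\<^sup>2 + (x $ 2 - y $ 2)\<^sup>2)" for x y :: "real^2"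
  by (simp add: dist_vec_def L2_set_def sum_2 dist_real_def)

text \<open>The triangle has sides of length 1, so the unit ball about a vertex is a closed convex
  set containing all vertices.\<close>

lemma dist_z_le:
  assumes "i \<in> {0, 1, 2}" "x \<in> gasket"
  shows "dist (z i) x \<le> 1"
proof -
  have "gasket \<subseteq> cball (z i) 1"
    by (rule gasket_subset_closed_convex)
      (use assms(1) in \<open>auto simp: dist_real2 z_components power_divide\<close>)
  with assms(2) show ?thesis by auto
qed

lemma dist_gasket_le: "x \<in> gasket \<Longrightarrow> y \<in> gasket \<Longrightarrow> dist x y \<le> 2"
  using dist_z_le[of 0 x] dist_z_le[of 0 y] dist_triangle3[of x y "z 0"] by simp

section \<open>Words and cells\<close>

lemma fw_simps [simp]: "fw [] = id" "fw (i # w) = f i \<circ> fw w"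
  by (auto simp: fw_def)

lemma fw_append: "fw (u @ w) = fw u \<circ> fw w"
  by (induction u) auto

lemma dist_fw: "dist (fw w x) (fw w y) = dist x y * (1/2) ^ length w"
  by (induction w) (auto simp: dist_f)

lemma cell_Nil [simp]: "cell [] = gasket"
  by (simp add: cell_def)

lemma cell_Cons: "cell (i # w) = f i ` cell w"
  by (simp add: cell_def image_image)

lemma cell_append: "cell (u @ w) = fw u ` cell w"
  by (simp add: cell_def image_image fw_append)

lemma words_0: "words 0 = {[]}"
  by (auto simp: words_def)

lemma words_Suc: "words (Suc n) = (\<Union>i\<in>{0, 1, 2}. Cons i ` words n)"
  by (auto simp: words_def length_Suc_conv image_iff)

lemma words_add: "words (n + m) = (\<lambda>(u, w). u @ w) ` (words n \<times> words m)"
proof (intro equalityI subsetI)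
  fix x assume x: "x \<in> words (n + m)"
  then have "x = (\<lambda>(u, w). u @ w) (take n x, drop n x)" by simp
  moreover have "(take n x, drop n x) \<in> words n \<times> words m"
    using x by (auto simp: words_def dest: in_set_takeD in_set_dropD)
  ultimately show "x \<in> (\<lambda>(u, w). u @ w) ` (words n \<times> words m)" by (rule image_eqI)
qed (auto simp: words_def)

lemma length_words: "w \<in> words n \<Longrightarrow> length w = n"
  by (simp add: words_def)

text \<open>All first components have length \<open>n\<close>, which fixes where the concatenation
  splits.\<close>

lemma inj_on_append: "inj_on (\<lambda>(u, w). u @ w) (words n \<times> X)"
  by (auto simp: inj_on_def length_words)

lemma card_words: "card (words n) = 3 ^ n"
  using card_lists_length_eq[of "{0, 1, 2::nat}" n]
  by (simp add: words_def conj_commute numeral_3_eq_3)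

lemma fw_in_gasket: "w \<in> words n \<Longrightarrow> x \<in> gasket \<Longrightarrow> fw w x \<in> gasket"
  by (induction w arbitrary: n) (auto simp: words_def intro: f_in_gasket)

lemma cell_subset_gasket: "w \<in> words n \<Longrightarrow> cell w \<subseteq> gasket"
  by (auto simp: cell_def fw_in_gasket)

lemma cell_append_subset: "w \<in> words n \<Longrightarrow> cell (u @ w) \<subseteq> cell u"
  unfolding cell_append cell_def[of u] by (intro image_mono cell_subset_gasket)

lemma cell_nonempty: "cell w \<noteq> {}"
  using gasket_props(2) by (simp add: cell_def)

lemma gasket_eq_UN_cells: "gasket = (\<Union>w\<in>words n. cell w)"
proof (induction n)
  case (Suc n)
  have "gasket = (\<Union>i\<in>{0, 1, 2}. f i ` (\<Union>w\<in>words n. cell w))"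
    using gasket_props(3) Suc by (simp add: F_UN)
  then show ?case by (simp add: words_Suc cell_Cons image_UN)
qed (simp add: words_0)

lemma cell_eq_UN_cells: "cell u = (\<Union>w\<in>words n. cell (u @ w))"
  unfolding cell_append image_UN[symmetric] gasket_eq_UN_cells[of n, symmetric] by (rule cell_def)

lemma dist_cell_le: "x \<in> cell w \<Longrightarrow> y \<in> cell w \<Longrightarrow> dist x y \<le> 2 * (1/2) ^ length w"
  by (auto simp: cell_def dist_fw intro!: mult_right_mono dist_gasket_le)

section \<open>The proportion of cells meeting a set\<close>

definition meeting :: "nat \<Rightarrow> (real^2) set \<Rightarrow> nat list set" where
  "meeting n X = {w \<in> words n. cell w \<inter> X \<noteq> {}}"

definition content :: "nat \<Rightarrow> (real^2) set \<Rightarrow> real" where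
  "content n X = card (meeting n X) / 3 ^ n"

lemma finite_meeting [simp]: "finite (meeting n X)"
  using finite_words by (simp add: meeting_def)

lemma content_nonneg [simp]: "0 \<le> content n X"
  by (simp add: content_def)

lemma content_gasket: "content n gasket = 1"
proof -
  have "meeting n gasket = words n"
    using cell_subset_gasket cell_nonempty by (auto simp: meeting_def Int_absorb2)
  then show ?thesis by (simp add: content_def card_words)
qed

lemma content_mono: "X \<inter> gasket \<subseteq> Y \<Longrightarrow> content n X \<le> content n Y"
  unfolding content_def
proof (intro divide_right_mono of_nat_mono card_mono)
  show "meeting n X \<subseteq> meeting n Y" if "X \<inter> gasket \<subseteq> Y"
    unfolding meeting_def using that cell_subset_gasket by blast
qed auto

lemma content_eq_0: "X \<inter> gasket = {} \<Longrightarrow> content n X = 0"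
  using content_mono[of X "{}" n] content_nonneg[of n X]
  by (simp add: content_def[of _ "{}"] meeting_def[of _ "{}"])

lemma content_UN_le:
  assumes "finite I"
  shows "content n (\<Union>i\<in>I. X i) \<le> (\<Sum>i\<in>I. content n (X i))"
proof -
  have "meeting n (\<Union>i\<in>I. X i) = (\<Union>i\<in>I. meeting n (X i))" by (auto simp: meeting_def)
  then have "real (card (meeting n (\<Union>i\<in>I. X i))) \<le> (\<Sum>i\<in>I. real (card (meeting n (X i))))"
    using card_UN_le[OF assms, of "\<lambda>i. meeting n (X i)"]
    by (metis of_nat_le_iff of_nat_sum)
  then show ?thesis
    by (simp add: content_def sum_divide_distrib[symmetric] divide_right_mono)
qed

text \<open>\<open>cell (i # w)\<close> meets \<open>X\<close> exactly if \<open>cell w\<close>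
  meets the preimage of \<open>X\<close> under \<open>f i\<close>. Words are counted rather than
  points, so equality holds although neighbouring cells share points.\<close>

lemma content_Suc: "content (Suc n) X = (\<Sum>i\<in>{0, 1, 2}. content n (f i -` X)) / 3"
proof -
  have "meeting (Suc n) X = (\<Union>i\<in>{0, 1, 2}. Cons i ` meeting n (f i -` X))"
    by (auto simp: meeting_def words_Suc cell_Cons image_iff; blast)
  moreover have "card \<dots> = (\<Sum>i\<in>{0, 1, 2}. card (Cons i ` meeting n (f i -` X)))"
    by (intro card_UN_disjoint) auto
  ultimately have "card (meeting (Suc n) X) = (\<Sum>i\<in>{0, 1, 2}. card (meeting n (f i -` X)))"
    by (simp add: card_image)
  then show ?thesis by (simp add: content_def field_simps)
qed

text \<open>A word counted at level \<open>n + 1\<close> extends one counted at level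
  \<open>n\<close>, and each word has three extensions.\<close>

lemma content_Suc_le: "content (Suc n) X \<le> content n X"
proof -
  have "meeting (n + 1) X \<subseteq> (\<lambda>(u, w). u @ w) ` (meeting n X \<times> words 1)"
  proof
    fix x assume x: "x \<in> meeting (n + 1) X"
    then have "x \<in> words (n + 1)" unfolding meeting_def by blast
    then obtain u w where uw: "x = u @ w" "u \<in> words n" "w \<in> words 1"
      unfolding words_add by auto
    then have "u \<in> meeting n X"
      using x cell_append_subset[OF uw(3), of u] by (auto simp: meeting_def)
    with uw show "x \<in> (\<lambda>(u, w). u @ w) ` (meeting n X \<times> words 1)" by auto
  qed
  then have "card (meeting (n + 1) X) \<le> card ((\<lambda>(u, w). u @ w) ` (meeting n X \<times> words 1))"
    by (intro card_mono) (auto simp: finite_words)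
  also have "\<dots> \<le> card (meeting n X \<times> words 1)"
    by (intro card_image_le) (auto simp: finite_words)
  also have "\<dots> = 3 * card (meeting n X)" by (simp add: card_cartesian_product card_words)
  finally show ?thesis by (simp add: content_def field_simps)
qed

lemma content_antimono: "m \<le> n \<Longrightarrow> content n X \<le> content m X"
  using lift_Suc_antimono_le[of "\<lambda>n. content n X"] content_Suc_le by blast

section \<open>Metric separation and the symmetries of the triangle\<close>

lemma component_diff_le_dist:
  fixes x y :: "real^2"
  shows "\<bar>x $ i - y $ i\<bar> \<le> dist x y"
  using dist_vec_nth_le[of x i y] by (simp add: dist_real_def)

lemma sqrt3_bounds: "17/10 < sqrt 3" "sqrt 3 < 18/10"
  by (rule real_less_rsqrt, simp add: power2_eq_square)
    (rule real_less_lsqrt, simp_all add: power2_eq_square)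

text \<open>The left side is the inner product of \<open>y - x\<close> with the unit normal
  \<open>(sqrt 3, -1) / 2\<close> of the side from \<open>z 0\<close> to \<open>z 2\<close>. The two
  squares in the identity are the squared coordinates in a rotated orthonormal basis.\<close>

lemma oblique_diff_le_dist:
  fixes x y :: "real^2"
  shows "(sqrt 3 * (y $ 1 - x $ 1) - (y $ 2 - x $ 2)) / 2 \<le> dist x y"
proof -
  define a b where "a = y $ 1 - x $ 1" and "b = y $ 2 - x $ 2"
  have "((sqrt 3 * a - b) / 2)\<^sup>2 + ((a + sqrt 3 * b) / 2)\<^sup>2 = a\<^sup>2 + b\<^sup>2"
    by (simp add: power2_eq_square field_simps)
  then have "((sqrt 3 * a - b) / 2)\<^sup>2 \<le> a\<^sup>2 + b\<^sup>2"
    using zero_le_power2[of "(a + sqrt 3 * b) / 2"] by linarith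
  then have "(sqrt 3 * a - b) / 2 \<le> sqrt (a\<^sup>2 + b\<^sup>2)" by (rule real_le_rsqrt)
  then show ?thesis by (simp add: a_def b_def dist_real2 power2_commute)
qed

text \<open>Conjugation by \<sigma> permutes the maps \<open>f i\<close> through \<pi>, so \<sigma>
  sends \<open>cell w\<close> into \<open>cell (map \<pi> w)\<close>. Relabelling letters therefore
  injects the words counted for one ball into those counted for its image.\<close>

lemma content_cball_symmetry:
  assumes \<sigma>: "\<And>x y. dist (\<sigma> x) (\<sigma> y) = dist x y" "\<And>x. \<sigma> (\<sigma> x) = x"
    and \<pi>: "\<pi> ` {0, 1, 2} \<subseteq> {0, 1, 2}" "inj_on \<pi> {0, 1, 2}"
    and conj: "\<And>i x. i \<in> {0, 1, 2} \<Longrightarrow> \<sigma> (f i x) = f (\<pi> i) (\<sigma> x)"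
  shows "\<sigma> ` gasket \<subseteq> gasket" "content n (cball x r) \<le> content n (cball (\<sigma> x) r)"
proof -
  have cont: "continuous_on UNIV \<sigma>"
    by (rule continuous_onI) (use \<sigma>(1) in \<open>auto intro: exI[of _ "_::real"]\<close>)
  have "gasket \<subseteq> \<sigma> -` gasket"
  proof (rule gasket_subset_closed_invariant)
    show "closed (\<sigma> -` gasket)"
      using continuous_closed_vimage[OF compact_imp_closed[OF gasket_props(1)], of \<sigma>] cont
      by (simp add: continuous_on_eq_continuous_at)
    show "\<sigma> -` gasket \<noteq> {}" using gasket_props(2) \<sigma>(2) by (metis all_not_in_conv vimageI2)
    show "f i y \<in> \<sigma> -` gasket" if "i \<in> {0, 1, 2}" "y \<in> \<sigma> -` gasket" for i y
      using that conj f_in_gasket[of "\<pi> i" "\<sigma> y"] \<pi>(1) by auto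
  qed
  then show g: "\<sigma> ` gasket \<subseteq> gasket" by blast
  have cell: "\<sigma> ` cell w \<subseteq> cell (map \<pi> w)" if "set w \<subseteq> {0, 1, 2}" for w
    using that
  proof (induction w)
    case (Cons i w)
    have "\<sigma> ` cell (i # w) = f (\<pi> i) ` \<sigma> ` cell w"
      using conj[of i] Cons.prems by (simp add: cell_Cons image_image)
    with Cons show ?case by (auto simp: cell_Cons)
  qed (use g in simp)
  have "map \<pi> ` meeting n (cball x r) \<subseteq> meeting n (cball (\<sigma> x) r)"
  proof
    fix w' assume "w' \<in> map \<pi> ` meeting n (cball x r)"
    then obtain w where w: "w' = map \<pi> w" "w \<in> words n" and "cell w \<inter> cball x r \<noteq> {}"
      by (auto simp: meeting_def)
    then obtain y where y: "y \<in> cell w" "dist x y \<le> r" by auto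
    have "\<sigma> y \<in> cell w'" using cell[of w] w y by (auto simp: words_def)
    moreover have "dist (\<sigma> x) (\<sigma> y) \<le> r" using y by (simp add: \<sigma>)
    moreover have "w' \<in> words n" using w \<pi>(1) by (auto simp: words_def)
    ultimately show "w' \<in> meeting n (cball (\<sigma> x) r)" by (auto simp: meeting_def)
  qed
  moreover have "inj_on (map \<pi>) (meeting n (cball x r))"
    by (rule inj_onI, rule map_inj_on, assumption, rule inj_on_subset[OF \<pi>(2)])
      (auto simp: meeting_def words_def)
  ultimately have "card (meeting n (cball x r)) \<le> card (meeting n (cball (\<sigma> x) r))"
    by (intro card_inj_on_le[of "map \<pi>"]) auto
  then show "content n (cball x r) \<le> content n (cball (\<sigma> x) r)"
    by (simp add: content_def divide_right_mono)
qed

text \<open>Supporting lines of the triangle; on it, \<open>sqrt 3 * x $ 1 - x $ 2\<close> is twice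
  the distance from the line through \<open>z 0\<close> and \<open>z 2\<close>.\<close>

lemma gasket_bounds:
  assumes "x \<in> gasket"
  shows "0 \<le> x $ 1" "x $ 1 \<le> 1" "0 \<le> x $ 2" "x $ 2 \<le> sqrt 3 / 2"
    "0 \<le> sqrt 3 * x $ 1 - x $ 2" "sqrt 3 * x $ 1 - x $ 2 \<le> sqrt 3"
  using gasket_halfplane[OF assms, of 0 "-1" 0] gasket_halfplane[OF assms, of 1 1 0]
    gasket_halfplane[OF assms, of 0 0 "-1"] gasket_halfplane[OF assms, of "sqrt 3 / 2" 0 1]
    gasket_halfplane[OF assms, of 0 "- sqrt 3" 1] gasket_halfplane[OF assms, of "sqrt 3" "sqrt 3" "-1"]
  by (simp_all add: algebra_simps)

text \<open>Reflection in the vertical line through \<open>z 2\<close>, exchanging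
  \<open>z 0\<close> and \<open>z 1\<close>.\<close>

definition refl01 :: "real^2 \<Rightarrow> real^2" where
  "refl01 x = vector [1 - x $ 1, x $ 2]"

text \<open>Reflection in the line through \<open>z 0\<close> at 30 degrees to the horizontal,
  exchanging \<open>z 1\<close> and \<open>z 2\<close>.\<close>

definition refl12 :: "real^2 \<Rightarrow> real^2" where
  "refl12 x = vector [x $ 1 / 2 + sqrt 3 / 2 * x $ 2, sqrt 3 / 2 * x $ 1 - x $ 2 / 2]"

lemma refl01_f: "refl01 (f 0 x) = f 1 (refl01 x)" "refl01 (f 1 x) = f 0 (refl01 x)"
    "refl01 (f 2 x) = f 2 (refl01 x)"
  by (simp_all add: vec_eq_iff forall_2 f_component z_components refl01_def vector_2 field_simps)

lemma refl12_f: "refl12 (f 0 x) = f 0 (refl12 x)" "refl12 (f 1 x) = f 2 (refl12 x)"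
    "refl12 (f 2 x) = f 1 (refl12 x)"
  by (simp_all add: vec_eq_iff forall_2 f_component z_components refl12_def vector_2 field_simps)

lemma refl01_symmetry:
  shows "refl01 ` gasket \<subseteq> gasket" "content n (cball x r) \<le> content n (cball (refl01 x) r)"
proof -
  have *: "dist (refl01 x) (refl01 y) = dist x y" "refl01 (refl01 x) = x"
    "i \<in> {0, 1, 2} \<Longrightarrow> refl01 (f i x) = f (Transposition.transpose 0 1 i) (refl01 x)" for x y i
    subgoal by (simp add: dist_real2 refl01_def vector_2 power2_commute)
    subgoal by (simp add: refl01_def vec_eq_iff forall_2 vector_2)
    subgoal using refl01_f by (auto simp: Transposition.transpose_def)
    done
  show "refl01 ` gasket \<subseteq> gasket" "content n (cball x r) \<le> content n (cball (refl01 x) r)"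
    by (rule content_cball_symmetry[OF *(1,2) _ _ *(3)]; auto simp: Transposition.transpose_def inj_on_def)+
qed

lemma refl12_symmetry:
  shows "refl12 ` gasket \<subseteq> gasket" "content n (cball x r) \<le> content n (cball (refl12 x) r)"
proof -
  have *: "dist (refl12 x) (refl12 y) = dist x y" "refl12 (refl12 x) = x"
    "i \<in> {0, 1, 2} \<Longrightarrow> refl12 (f i x) = f (Transposition.transpose 1 2 i) (refl12 x)" for x y i
    subgoal
    proof -
      define a b where "a = x $ 1 - y $ 1" and "b = x $ 2 - y $ 2"
      have "((a + sqrt 3 * b) / 2)\<^sup>2 + ((sqrt 3 * a - b) / 2)\<^sup>2 = a\<^sup>2 + b\<^sup>2"
        by (simp add: power2_eq_square field_simps)
      moreover have "refl12 x $ 1 - refl12 y $ 1 = (a + sqrt 3 * b) / 2"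
        "refl12 x $ 2 - refl12 y $ 2 = (sqrt 3 * a - b) / 2"
        by (simp_all add: refl12_def vector_2 a_def b_def field_simps)
      ultimately show ?thesis by (simp only: dist_real2) (simp add: a_def b_def)
    qed
    subgoal by (simp add: refl12_def vec_eq_iff forall_2 vector_2 field_simps)
    subgoal using refl12_f by (auto simp: Transposition.transpose_def)
    done
  show "refl12 ` gasket \<subseteq> gasket" "content n (cball x r) \<le> content n (cball (refl12 x) r)"
    by (rule content_cball_symmetry[OF *(1,2) _ _ *(3)]; auto simp: Transposition.transpose_def inj_on_def)+
qed

section \<open>Doubling small balls centred in \<open>cell [0, 1]\<close>\<close>

lemma doubling_0:
  assumes "x = f 0 (f 1 (f j y))" "j \<in> {0, 2}" "y \<in> gasket" "d < sqrt 3 / 16"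
  shows "content (Suc n) (cball x d) \<le> content n (cball (f 1 (f j y)) (2 * d)) / 3"
proof -
  \<comment> \<open>The subcells with \<open>j\<close> equal to 0 or 2 stay at distance at least
    \<open>sqrt 3 / 16\<close> from the copies \<open>f 1\<close> and \<open>f 2\<close> of the
    gasket. The oblique estimate separates them from \<open>f 1\<close>, the vertical coordinate
    from \<open>f 2\<close>.\<close>
  have "f i -` cball x d \<inter> gasket = {}" if i: "i \<in> {1, 2}" for i
  proof (rule ccontr)
    assume "f i -` cball x d \<inter> gasket \<noteq> {}"
    then obtain u where u: "u \<in> gasket" "dist x (f i u) \<le> d" by auto
    have "dist x (f i u) < sqrt 3 / 16" using u(2) assms(4) by simp
    then have "\<bar>x $ 1 - f i u $ 1\<bar> < sqrt 3 / 16" "\<bar>x $ 2 - f i u $ 2\<bar> < sqrt 3 / 16"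
        "(sqrt 3 * (f i u $ 1 - x $ 1) - (f i u $ 2 - x $ 2)) / 2 < sqrt 3 / 16"
      using component_diff_le_dist[of x 1 "f i u"] component_diff_le_dist[of x 2 "f i u"]
        oblique_diff_le_dist[of "f i u" x] by linarith+
    then show False
      using i assms(1,2) gasket_bounds[OF u(1)] gasket_bounds[OF assms(3)] sqrt3_bounds
      by (auto simp: f_component z_components algebra_simps abs_less_iff; argo)
  qed
  then have "content n (f 1 -` cball x d) = 0" "content n (f 2 -` cball x d) = 0"
    by (auto intro: content_eq_0)
  \<comment> \<open>Only the branch \<open>f 0\<close> contributes, and undoing \<open>f 0\<close>
    doubles the radius.\<close>
  then show ?thesis
    by (simp add: content_Suc assms(1) f_vimage_cball)
qed

text \<open>Dilation by 2 about the junction \<open>f 0 (z 1) = f 1 (z 0)\<close> sends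
  \<open>f 0 (f 1 p)\<close> to \<open>f 0 p\<close> and \<open>f 1 (f 0 u)\<close> to
  \<open>f 1 u\<close>.\<close>

lemma junction_doubling_vimage:
  "f 1 -` (f 0 -` cball (f 0 (f 1 p)) d) = f 0 -` cball (f 0 p) (2 * d)"
  "f 0 -` (f 1 -` cball (f 0 (f 1 p)) d) = f 1 -` cball (f 0 p) (2 * d)"
proof -
  have "dist (f 0 p) (f 0 u) = 2 * dist (f 0 (f 1 p)) (f 0 (f 1 u))" for u
    by (simp add: dist_f)
  then show "f 1 -` (f 0 -` cball (f 0 (f 1 p)) d) = f 0 -` cball (f 0 p) (2 * d)" by auto
  have "f 0 p - f 1 u = 2 *\<^sub>R (f 0 (f 1 p) - f 1 (f 0 u))" for u
    by (simp add: vec_eq_iff forall_2 f_component z_components field_simps)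
  then have "dist (f 0 p) (f 1 u) = 2 * dist (f 0 (f 1 p)) (f 1 (f 0 u))" for u
    by (simp only: dist_norm) simp
  then show "f 0 -` (f 1 -` cball (f 0 (f 1 p)) d) = f 1 -` cball (f 0 p) (2 * d)" by auto
qed

text \<open>Here the subcell touches the junction. The ball can meet only the second-level cells
  \<open>[0, 1]\<close> and \<open>[1, 0]\<close>, which the dilation about the junction turns into
  the cells \<open>[0]\<close> and \<open>[1]\<close>. Two levels are peeled off the small ball but
  one off the doubled ball, which leaves the factor 3.\<close>

lemma doubling_1:
  assumes "x = f 0 (f 1 (f 1 y))" "y \<in> gasket" "d < sqrt 3 / 16"
  shows "content (Suc (Suc n)) (cball x d) \<le> content (Suc n) (cball (f 0 (f 1 y)) (2 * d)) / 3"
proof -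
  have zero: "content n (f j -` f i -` cball x d) = 0"
    if ij: "i \<in> {0, 1, 2}" "j \<in> {0, 1, 2}" "(i, j) \<notin> {(0, 1), (1, 0)}" for i j
  proof (rule content_eq_0, rule ccontr)
    assume "f j -` f i -` cball x d \<inter> gasket \<noteq> {}"
    then obtain u where u: "u \<in> gasket" "dist x (f i (f j u)) \<le> d" by auto
    have "dist x (f i (f j u)) < sqrt 3 / 16" using u(2) assms(3) by simp
    then have "\<bar>x $ 1 - f i (f j u) $ 1\<bar> < sqrt 3 / 16" "\<bar>x $ 2 - f i (f j u) $ 2\<bar> < sqrt 3 / 16"
      using component_diff_le_dist[of x 1 "f i (f j u)"] component_diff_le_dist[of x 2 "f i (f j u)"]
      by linarith+
    then show False
      using ij assms(1) gasket_bounds[OF u(1)] gasket_bounds[OF assms(2)] sqrt3_bounds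
      by (auto simp: f_component z_components algebra_simps abs_less_iff; argo)
  qed
  let ?B = "cball (f 0 (f 1 y)) (2 * d)"
  have "content (Suc (Suc n)) (cball x d)
      = (content n (f 1 -` f 0 -` cball x d) + content n (f 0 -` f 1 -` cball x d)) / 9"
    using zero[of 0 0] zero[of 0 2] zero[of 1 1] zero[of 1 2] zero[of 2 0] zero[of 2 1] zero[of 2 2]
    by (simp add: content_Suc)
  also have "\<dots> = (content n (f 0 -` ?B) + content n (f 1 -` ?B)) / 9"
    unfolding assms(1) junction_doubling_vimage by simp
  also have "\<dots> \<le> content (Suc n) ?B / 3"
    using content_nonneg[of n "f 2 -` ?B"] by (simp add: content_Suc)
  finally show ?thesis .
qed

text \<open>For \<open>j = 1\<close> the doubled centre is already in \<open>cell [0, 1]\<close>.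
  Otherwise it lies in the copy \<open>f 1\<close>: for \<open>j = 0\<close> the reflection
  \<open>refl01\<close> brings it back, for \<open>j = 2\<close> it only reaches
  \<open>cell [0, 2]\<close> and \<open>refl12\<close> completes the move.\<close>

lemma doubling:
  assumes "x \<in> cell [0, 1]" "d < sqrt 3 / 16"
  obtains x' where "x' \<in> cell [0, 1]"
    "\<And>n. content (Suc (Suc n)) (cball x d) \<le> content (Suc n) (cball x' (2 * d)) / 3"
proof -
  obtain p where p: "p \<in> gasket" "x = f 0 (f 1 p)" using assms(1) by (auto simp: cell_def)
  obtain j y where j: "j \<in> {0, 1, 2}" and y: "y \<in> gasket" "p = f j y"
    using gasketE[OF p(1)] by metis
  have r01: "refl01 y \<in> gasket" using refl01_symmetry(1) y(1) by blast
  then have r12: "refl12 (refl01 y) \<in> gasket" using refl12_symmetry(1) by blast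
  from j consider "j = 0" | "j = 1" | "j = 2" by auto
  then show thesis
  proof cases
    case 1
    show thesis
    proof (rule that)
      show "f 0 (f 1 (refl01 y)) \<in> cell [0, 1]" using r01 by (auto simp: cell_def)
      show "content (Suc (Suc n)) (cball x d) \<le> content (Suc n) (cball (f 0 (f 1 (refl01 y))) (2 * d)) / 3" for n
        using doubling_0[of x 0 y d "Suc n"] refl01_symmetry(2)[of "Suc n" "f 1 (f 0 y)" "2 * d"]
          p(2) y 1 assms(2) by (simp only: refl01_f) simp
    qed
  next
    case 2
    show thesis
    proof (rule that)
      show "f 0 (f 1 y) \<in> cell [0, 1]" using y by (auto simp: cell_def)
      show "content (Suc (Suc n)) (cball x d) \<le> content (Suc n) (cball (f 0 (f 1 y)) (2 * d)) / 3" for n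
        using doubling_1[of x y d n] p(2) y 2 assms(2) by simp
    qed
  next
    case 3
    show thesis
    proof (rule that)
      let ?y = "refl12 (refl01 y)"
      show "f 0 (f 1 ?y) \<in> cell [0, 1]" using r12 by (auto simp: cell_def)
      show "content (Suc (Suc n)) (cball x d) \<le> content (Suc n) (cball (f 0 (f 1 ?y)) (2 * d)) / 3" for n
        using doubling_0[of x 2 y d "Suc n"] refl01_symmetry(2)[of "Suc n" "f 1 (f 2 y)" "2 * d"]
          refl12_symmetry(2)[of "Suc n" "f 0 (f 2 (refl01 y))" "2 * d"]
          p(2) y 3 assms(2) by (simp only: refl01_f refl12_f) simp
    qed
  qed
qed

section \<open>Corners of cells and the measures \<open>mu k\<close>\<close>

definition corner :: "nat list \<Rightarrow> real^2" where
  "corner w = fw w (z (last w))"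

lemma last_words: "w \<in> words n \<Longrightarrow> n \<ge> 1 \<Longrightarrow> last w \<in> {0, 1, 2}"
proof -
  assume w: "w \<in> words n" "n \<ge> 1"
  then have "w \<noteq> []" by (auto simp: words_def)
  from last_in_set[OF this] w show ?thesis unfolding words_def by blast
qed

text \<open>Since \<open>f j\<close> fixes \<open>z j\<close>, the last letter just selects a
  vertex. Words of length \<open>k\<close> thus index the atoms of \<open>mu k\<close> with
  multiplicity, each word carrying mass \<open>1 / 3 ^ k\<close>.\<close>

lemma corner_snoc: "corner (w @ [j]) = fw w (z j)"
  by (simp add: corner_def fw_append)

lemma words_1: "words 1 = (\<lambda>j. [j]) ` {0, 1, 2}"
  by (simp add: words_Suc words_0 insert_commute)

lemma bij_betw_snoc_words:
  assumes "k \<ge> 1"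
  shows "bij_betw (\<lambda>(w, j). w @ [j]) (words (k - 1) \<times> {0, 1, 2}) (words k)"
proof -
  have "words k = (\<lambda>(u, w). u @ w) ` (words (k - 1) \<times> words 1)"
    using assms words_add[of "k - 1" 1] by simp
  then have "words k = (\<lambda>(w, j). w @ [j]) ` (words (k - 1) \<times> {0, 1, 2})"
    unfolding words_1 by auto
  then show ?thesis by (auto simp: bij_betw_def inj_on_def)
qed

text \<open>The corner is a vertex of the cell, so the factor 2 of \<open>dist_cell_le\<close> is
  avoided.\<close>

lemma dist_corner_cell_le:
  assumes "w \<in> words n" "n \<ge> 1" "x \<in> cell w"
  shows "dist (corner w) x \<le> (1/2) ^ n"
  using assms dist_z_le[OF last_words[OF assms(1,2)]]
  by (auto simp: cell_def corner_def dist_fw length_words)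

lemma measure_mu:
  assumes k: "k \<ge> 1" and X: "X \<in> sets borel"
  shows "measure (mu k) X = card {w \<in> words k. corner w \<in> X} / 3 ^ k"
proof -
  have "(\<Sum>w\<in>words (k - 1). \<Sum>j\<in>{0, 1, 2}. indicator X (fw w (z j)) :: ennreal)
      = (\<Sum>(w, j)\<in>words (k - 1) \<times> {0, 1, 2}. indicator X (corner (w @ [j])))"
    by (simp only: sum.cartesian_product corner_snoc)
  also have "\<dots> = (\<Sum>w\<in>words k. indicator X (corner w))"
    using sum.reindex_bij_betw[OF bij_betw_snoc_words[OF k], of "\<lambda>w. indicator X (corner w) :: ennreal"]
    by (simp add: case_prod_unfold)
  also have "\<dots> = of_nat (card {w \<in> words k. corner w \<in> X})"
    using finite_words[of k] by (simp add: indicator_def Collect_conj_eq)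
  finally have "emeasure (mu k) X = ennreal (1 / 3 ^ k) * ennreal (card {w \<in> words k. corner w \<in> X})"
    by (simp add: emeasure_mu[OF X] ennreal_of_nat_eq_real_of_nat)
  then show ?thesis
    by (simp add: measure_def ennreal_mult[symmetric])
qed

lemma F_funpow: "(F ^^ n) X = (\<Union>w\<in>words n. fw w ` X)"
proof (induction n)
  case (Suc n)
  then show ?case by (simp add: F_UN words_Suc image_UN image_image)
qed (simp add: words_0)

lemma approx_eq_corners:
  assumes "k \<ge> 1"
  shows "approx k = corner ` words k"
proof -
  have "approx k = (\<lambda>(w, j). corner (w @ [j])) ` (words (k - 1) \<times> {0, 1, 2})"
    by (simp add: approx_def F_funpow corner_snoc case_prod_unfold) force
  also have "\<dots> = corner ` (\<lambda>(w, j). w @ [j]) ` (words (k - 1) \<times> {0, 1, 2})"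
    by (simp add: image_image case_prod_unfold)
  also have "\<dots> = corner ` words k"
    using bij_betw_snoc_words[OF assms] by (simp add: bij_betw_def)
  finally show ?thesis .
qed

lemma approx_dense_in_cell:
  assumes "x \<in> cell [0, 1]" "k \<ge> 3"
  obtains x' where "x' \<in> approx k \<inter> cell [0, 1]" "dist x' x \<le> (1/2) ^ k"
proof -
  have "x \<in> (\<Union>u\<in>words (k - 2). cell ([0, 1] @ u))"
    using assms(1) cell_eq_UN_cells[of "[0, 1]" "k - 2"] by simp
  then obtain u where u: "u \<in> words (k - 2)" "x \<in> cell ([0, 1] @ u)" by blast
  have w: "[0, 1] @ u \<in> words k" using u assms(2) by (auto simp: words_def)
  show thesis
  proof (rule that)
    \<comment> \<open>The last letter then comes from \<open>u\<close>, so the corner is the image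
      under \<open>fw [0, 1]\<close> of a point of the gasket.\<close>
    have "u \<noteq> []" using u assms(2) by (auto simp: words_def)
    moreover have "last u \<in> {0, 1, 2}" using last_words[OF u(1)] assms(2) by simp
    ultimately have "corner ([0, 1] @ u) \<in> cell [0, 1]"
      using fw_in_gasket[OF u(1) z_in_gasket] by (auto simp: corner_def cell_def fw_append)
    then show "corner ([0, 1] @ u) \<in> approx k \<inter> cell [0, 1]"
      using w approx_eq_corners[of k] assms(2) by simp
    show "dist (corner ([0, 1] @ u)) x \<le> (1/2) ^ k"
      using dist_corner_cell_le[OF w _ u(2)] assms(2) by simp
  qed
qed

section \<open>Connectedness of the discrete approximations\<close>

definition step_rel :: "nat \<Rightarrow> (real^2) rel" where
  "step_rel n = {(x, y). x \<in> (F ^^ n) {z 0, z 1, z 2} \<and> y \<in> (F ^^ n) {z 0, z 1, z 2}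
     \<and> dist x y \<le> (1/2) ^ n}"

lemma f_step_rel:
  assumes "(x, y) \<in> (step_rel n)\<^sup>*" "i \<in> {0, 1, 2}"
  shows "(f i x, f i y) \<in> (step_rel (Suc n))\<^sup>*"
  using assms(1)
proof induction
  case (step y y')
  have "(f i y, f i y') \<in> step_rel (Suc n)"
    using step(2) assms(2) by (auto simp: step_rel_def dist_f F_UN)
  with step(3) show ?case by (rule rtrancl_into_rtrancl)
qed simp

lemma z_in_funpow: "i \<in> {0, 1, 2} \<Longrightarrow> z i \<in> (F ^^ n) {z 0, z 1, z 2}"
proof (induction n)
  case (Suc n)
  then have "f i (z i) \<in> F ((F ^^ n) {z 0, z 1, z 2})" unfolding F_UN by blast
  then show ?case by simp
qed auto

lemma f_z_commute: "f i (z j) = f j (z i)"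
  by (simp add: f_eq_midpoint)

text \<open>The copies under \<open>f i\<close> and \<open>f j\<close> share the point
  \<open>f i (z j) = f j (z i)\<close>: a path runs to it inside the first copy and continues inside
  the second.\<close>

lemma step_rel_connected:
  assumes "x \<in> (F ^^ n) {z 0, z 1, z 2}" "y \<in> (F ^^ n) {z 0, z 1, z 2}"
  shows "(x, y) \<in> (step_rel n)\<^sup>*"
  using assms
proof (induction n arbitrary: x y)
  case 0
  then have "y \<in> gasket" using z_in_gasket by auto
  then have "dist x y \<le> 1" using 0(1) dist_z_le[of _ y] by auto
  with 0 have "(x, y) \<in> step_rel 0" by (simp add: step_rel_def)
  then show ?case by blast
next
  case (Suc n)
  have split: "\<exists>i\<in>{0, 1, 2}. \<exists>a\<in>(F ^^ n) {z 0, z 1, z 2}. u = f i a"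
    if "u \<in> (F ^^ Suc n) {z 0, z 1, z 2}" for u
  proof -
    have "u \<in> (\<Union>i\<in>{0, 1, 2}. f i ` (F ^^ n) {z 0, z 1, z 2})"
      using that by (simp only: funpow.simps o_apply F_UN)
    then show ?thesis by blast
  qed
  obtain i a where i: "i \<in> {0, 1, 2}" and a: "a \<in> (F ^^ n) {z 0, z 1, z 2}" "x = f i a"
    using split[OF Suc.prems(1)] by (elim bexE)
  obtain j b where j: "j \<in> {0, 1, 2}" and b: "b \<in> (F ^^ n) {z 0, z 1, z 2}" "y = f j b"
    using split[OF Suc.prems(2)] by (elim bexE)
  have "(x, f i (z j)) \<in> (step_rel (Suc n))\<^sup>*"
    unfolding a(2) using i j a(1) by (intro f_step_rel Suc.IH z_in_funpow)
  moreover have "(f i (z j), y) \<in> (step_rel (Suc n))\<^sup>*"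
    unfolding b(2) f_z_commute[of i j] using i j b(1) by (intro f_step_rel Suc.IH z_in_funpow)
  ultimately show ?case by (rule rtrancl_trans)
qed

text \<open>Along a walk from \<open>x\<close> to \<open>y\<close> with steps of length at most
  \<open>(1/2) ^ (k - 1)\<close>, the distance from \<open>x\<close> cannot jump over the
  annulus.\<close>

lemma approx_meets_annulus:
  assumes xy: "x \<in> approx k" "y \<in> approx k" and r: "0 < r" "r \<le> dist x y"
  obtains p where "p \<in> approx k" "r \<le> dist x p" "dist x p \<le> r + (1/2) ^ (k - 1)"
proof -
  have "(x, y) \<in> (step_rel (k - 1))\<^sup>*" using xy step_rel_connected by (simp add: approx_def)
  then have "dist x y < r \<or> (\<exists>p\<in>approx k. r \<le> dist x p \<and> dist x p \<le> r + (1/2) ^ (k - 1))"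
  proof induction
    case (step y y')
    then have "dist x y' \<le> dist x y + (1/2) ^ (k - 1)" "y' \<in> approx k"
      using dist_triangle[of x y' y] by (auto simp: step_rel_def approx_def)
    with step(3) show ?case by (cases "dist x y' < r") force+
  qed (use r in simp)
  with r that show thesis by (metis not_less)
qed

section \<open>Density bounds for balls centred in the gasket\<close>

lemma C_le_inverse_theta: "(x, d) \<in> admissible k \<Longrightarrow> C k \<le> inverse (theta (mu k) sdim x d)"
  unfolding C_def using finite_admissible by (intro Min_le finite_imageI image_eqI) auto

lemma C_nonneg: "k \<ge> 4 \<Longrightarrow> 0 \<le> C k"
proof -
  assume "k \<ge> 4"
  then obtain x d where "inverse (theta (mu k) sdim x d) = C k"
    using C_attained[of k] by auto
  moreover have "0 \<le> theta (mu k) sdim x d" by (simp add: theta_def)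
  ultimately show ?thesis by (metis inverse_nonnegative_iff_nonnegative)
qed

lemma K_pos: "0 < K k"
proof -
  have "0 < 1 + 2 powi (5 - int k) / sqrt 3" by (intro add_pos_nonneg) auto
  then show ?thesis by (simp add: K_def)
qed

lemma two_powi_diff: "2 powi (a - int k) = 2 powi a * (1/2 :: real) ^ k"
  by (simp add: power_int_diff power_one_over)

text \<open>The ball is compared with an admissible pair \<open>(x', d')\<close> whose ball contains
  the corners of all level \<open>k\<close> cells meeting \<open>cball x d\<close>. The content is
  then at most a \<open>mu k\<close> measure to which the minimality of \<open>C k\<close>
  applies.\<close>

lemma density_bound_base:
  assumes k: "k \<ge> 4" and x: "x \<in> cell [0, 1]" and d: "sqrt 3 / 16 \<le> d" "d \<le> sqrt 3 / 8"
  shows "C_inf k * content k (cball x d) \<le> (2 * d) powr sdim"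
proof -
  obtain x' where x': "x' \<in> approx k \<inter> cell [0, 1]" "dist x' x \<le> (1/2) ^ k"
    using approx_dense_in_cell[OF x, of k] k by auto
  \<comment> \<open>The step length of the graph of corners. It is twice \<open>(1/2) ^ k\<close>:
    once for moving the centre to \<open>x'\<close>, once for passing from a point of a cell to its
    corner.\<close>
  define h where "h = (1/2 :: real) ^ (k - 1)"
  have h: "h = 2 * (1/2) ^ k" using k by (simp add: h_def power_diff)
  have h_pos: "0 < h" by (simp add: h_def)
  define Q where "Q = {y \<in> approx k. dist x' y \<le> d + h}"
  have Q: "finite Q" using finite_approx by (simp add: Q_def)
  \<comment> \<open>The largest distance from \<open>x'\<close> to a corner within
    \<open>d + h\<close>: being attained, it can be admissible, and replacing \<open>d + h\<close>
    by it loses no corner.\<close>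
  define d' where "d' = Max (dist x' ` Q)"
  have le_d': "dist x' y \<le> d'" if "y \<in> approx k" "dist x' y \<le> d + h" for y
    unfolding d'_def using Q that by (intro Max_ge) (auto simp: Q_def)
  have z0: "z 0 \<in> approx k" using z_in_funpow[of 0 "k - 1"] by (simp add: approx_def)
  obtain q where q: "q \<in> gasket" "x' = f 0 (f 1 q)" using x'(1) by (auto simp: cell_def)
  \<comment> \<open>\<open>z 0\<close> is far enough from \<open>x'\<close> for the annulus argument
    to yield a corner \<open>p\<close>, which keeps \<open>d'\<close> above the admissible lower
    bound.\<close>
  have "sqrt 3 / 16 \<le> 1/4" using sqrt3_bounds by simp
  also have "1/4 \<le> \<bar>x' $ 1 - z 0 $ 1\<bar>"
    using gasket_bounds[OF q(1)] by (simp add: q(2) f_component z_components)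
  also have "\<dots> \<le> dist x' (z 0)" by (rule component_diff_le_dist)
  finally obtain p where p: "p \<in> approx k" "sqrt 3 / 16 \<le> dist x' p" "dist x' p \<le> sqrt 3 / 16 + h"
    using approx_meets_annulus[of x' k "z 0" "sqrt 3 / 16"] x'(1) z0 by (auto simp: h_def)
  have d'_ge: "sqrt 3 / 16 \<le> d'" using le_d'[OF p(1)] p d by linarith
  have "p \<in> Q" using p d by (simp add: Q_def)
  then have "d' \<in> dist x' ` Q" unfolding d'_def using Q by (intro Max_in) auto
  then obtain y where y: "y \<in> approx k" "d' = dist x' y" "d' \<le> d + h" by (auto simp: Q_def)
  have "2 powi (1 - int k) = h" by (simp add: two_powi_diff h)
  then have "(x', d') \<in> admissible k"
    using x' y d'_ge d by (auto simp: admissible_def dist_norm norm_minus_commute)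
  then have C: "C k \<le> (2 * d') powr sdim / measure (mu k) (cball x' d')"
    using C_le_inverse_theta by (fastforce simp: theta_def)
  have "meeting k (cball x d) \<subseteq> {w \<in> words k. corner w \<in> cball x' d'}"
  proof
    fix w assume "w \<in> meeting k (cball x d)"
    then have w: "w \<in> words k" "cell w \<inter> cball x d \<noteq> {}" by (auto simp: meeting_def)
    then obtain u where u: "u \<in> cell w" "dist x u \<le> d" by auto
    have "dist x' (corner w) \<le> dist x' x + dist x u + dist (corner w) u"
      using dist_triangle[of x' "corner w" x] dist_triangle2[of x "corner w" u] by linarith
    also have "\<dots> \<le> d + h" using x'(2) u dist_corner_cell_le[OF w(1) _ u(1)] k h by simp
    finally have "dist x' (corner w) \<le> d'"
      using w(1) approx_eq_corners[of k] k by (intro le_d') auto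
    then show "w \<in> {w \<in> words k. corner w \<in> cball x' d'}" using w by simp
  qed
  then have "card (meeting k (cball x d)) \<le> card {w \<in> words k. corner w \<in> cball x' d'}"
    using finite_words by (intro card_mono) auto
  then have "content k (cball x d) \<le> measure (mu k) (cball x' d')"
    using k by (simp add: measure_mu content_def divide_right_mono)
  then have "C k * content k (cball x d) \<le> C k * measure (mu k) (cball x' d')"
    using C_nonneg[OF k] by (rule mult_left_mono)
  also have "\<dots> \<le> (2 * d') powr sdim"
    using C measure_nonneg[of "mu k" "cball x' d'"]
    by (cases "measure (mu k) (cball x' d') = 0") (auto simp: field_simps)
  also have "\<dots> \<le> (2 * d * (1 + 2 powi (5 - int k) / sqrt 3)) powr sdim"
  proof (rule powr_mono2)
    \<comment> \<open>As \<open>d\<close> is at least \<open>sqrt 3 / 16\<close>, the additive error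
      \<open>h\<close> becomes the relative error \<open>16 * h / sqrt 3\<close> occurring in
      \<open>K k\<close>.\<close>
    have "h = 16 * h / sqrt 3 * (sqrt 3 / 16)" by simp
    also have "\<dots> \<le> 16 * h / sqrt 3 * d" using d h_pos by (intro mult_left_mono) auto
    finally have "d + h \<le> d * (1 + 16 * h / sqrt 3)" by (simp add: algebra_simps)
    moreover have "2 powi (5 - int k) = 16 * h" by (simp add: two_powi_diff h)
    ultimately show "2 * d' \<le> 2 * d * (1 + 2 powi (5 - int k) / sqrt 3)" using y by simp
    show "0 \<le> 2 * d'" using y by simp
  qed (use sdim_pos in simp)
  also have "\<dots> = (2 * d) powr sdim * (1 + 2 powi (5 - int k) / sqrt 3) powr sdim"
    by (rule powr_mult)
  also have "\<dots> = (2 * d) powr sdim / K k"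
    unfolding K_def powr_minus by (simp only: divide_inverse inverse_inverse_eq)
  finally show ?thesis using K_pos[of k] by (simp add: C_inf_def field_simps)
qed

text \<open>\<open>m\<close> counts the doublings that bring the radius into
  \<open>[sqrt 3 / 16, sqrt 3 / 8)\<close>. Each one gains a factor 3 on both sides, because
  \<open>2 powr sdim = 3\<close>, and lowers the level by one; \<open>n \<ge> k + m\<close> keeps
  the level at least \<open>k\<close>.\<close>

lemma density_bound_junction:
  assumes k: "k \<ge> 4"
  shows "x \<in> cell [0, 1] \<Longrightarrow> sqrt 3 / 16 \<le> 2 ^ m * d \<Longrightarrow> 2 ^ m * d < sqrt 3 / 8 \<Longrightarrow> n \<ge> k + m
    \<Longrightarrow> C_inf k * content n (cball x d) \<le> (2 * d) powr sdim"
proof (induction m arbitrary: x d n)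
  case 0
  have "C_inf k * content n (cball x d) \<le> C_inf k * content k (cball x d)"
    using 0 C_nonneg[OF k] K_pos[of k]
    by (intro mult_left_mono content_antimono) (auto simp: C_inf_def)
  also have "\<dots> \<le> (2 * d) powr sdim" using 0 by (intro density_bound_base[OF k]) auto
  finally show ?case .
next
  case (Suc m)
  have "0 < 2 ^ Suc m * d" using Suc.prems(2) by (smt (verit) real_sqrt_gt_zero divide_pos_pos)
  then have d: "0 < d" by (simp add: zero_less_mult_iff)
  have "2 * d \<le> 2 ^ Suc m * d" using d by simp
  then have "d < sqrt 3 / 16" using Suc.prems(3) by linarith
  from doubling[OF Suc.prems(1) this] obtain x' where x': "x' \<in> cell [0, 1]"
    "\<And>n. content (Suc (Suc n)) (cball x d) \<le> content (Suc n) (cball x' (2 * d)) / 3" by blast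
  obtain n' where n': "n = Suc (Suc n')"
    using Suc.prems(4) k by (intro that[of "n - 2"]) linarith
  have "C_inf k * content n (cball x d) \<le> C_inf k * (content (Suc n') (cball x' (2 * d)) / 3)"
    unfolding n' using x'(2) C_nonneg[OF k] K_pos[of k]
    by (intro mult_left_mono) (auto simp: C_inf_def)
  also have "\<dots> \<le> (2 * (2 * d)) powr sdim / 3"
    using Suc.IH[OF x'(1), of "2 * d" "Suc n'"] Suc.prems n' by (simp add: mult.assoc mult.left_commute)
  also have "\<dots> = (2 * d) powr sdim"
    using d by (subst powr_mult) (auto simp: two_powr_sdim)
  finally show ?case .
qed

lemma density_bound:
  assumes k: "k \<ge> 4" and x: "x \<in> gasket" and d: "0 < d" "d < sqrt 3 / 2"
  shows "\<forall>\<^sub>F n in sequentially. C_inf k * content n (cball x d) \<le> (2 * d) powr sdim"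
proof -
  \<comment> \<open>\<open>f 0 \<circ> f 1\<close> divides the radius by 4. Minimality of
    \<open>m\<close> keeps the rescaled radius below \<open>sqrt 3 / 8\<close>; for
    \<open>m = 0\<close> the bound \<open>d < sqrt 3 / 2\<close> does so.\<close>
  define m where "m = (LEAST m. sqrt 3 / 16 \<le> 2 ^ m * (d / 4))"
  obtain m' where m': "sqrt 3 / 16 / (d / 4) < 2 ^ m'"
    using real_arch_pow[of 2 "sqrt 3 / 16 / (d / 4)"] by auto
  then have ex: "sqrt 3 / 16 \<le> 2 ^ m' * (d / 4)" using d by (simp add: field_simps)
  have m: "sqrt 3 / 16 \<le> 2 ^ m * (d / 4)" unfolding m_def using ex by (rule LeastI)
  have m_less: "2 ^ m * (d / 4) < sqrt 3 / 8"
  proof (cases m)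
    case (Suc l)
    then have "\<not> sqrt 3 / 16 \<le> 2 ^ l * (d / 4)"
      using not_less_Least[of l "\<lambda>m. sqrt 3 / 16 \<le> 2 ^ m * (d / 4)"] by (simp add: m_def)
    then show ?thesis by (simp add: Suc mult_ac)
  qed (use d in simp)
  have "C_inf k * content n (cball x d) \<le> (2 * d) powr sdim" if "n \<ge> k + m" for n
  proof -
    \<comment> \<open>Keeping one branch in each of two applications of self-similarity costs a
      factor 9, which is compensated by \<open>(1/4) powr sdim = 1/9\<close>.\<close>
    have "f 1 -` f 0 -` cball (f 0 (f 1 x)) (d / 4) = cball x d"
      by (simp add: f_vimage_cball)
    then have "content n (cball x d) \<le> 3 * content (Suc n) (f 0 -` cball (f 0 (f 1 x)) (d / 4))"
      by (simp add: content_Suc)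
    also have "\<dots> \<le> 9 * content (Suc (Suc n)) (cball (f 0 (f 1 x)) (d / 4))"
      by (simp add: content_Suc[of "Suc n"])
    finally have "C_inf k * content n (cball x d)
        \<le> 9 * (C_inf k * content (Suc (Suc n)) (cball (f 0 (f 1 x)) (d / 4)))"
      using C_nonneg[OF k] K_pos[of k] by (simp add: C_inf_def mult_left_mono mult.left_commute)
    also have "\<dots> \<le> 9 * (2 * (d / 4)) powr sdim"
      using x that m m_less
      by (intro mult_left_mono density_bound_junction[OF k, of _ m]) (auto simp: cell_def)
    also have "2 * (d / 4) = (1/2)\<^sup>2 * (2 * d)" by (simp add: power2_eq_square)
    also have "9 * ((1/2)\<^sup>2 * (2 * d)) powr sdim = (2 * d) powr sdim"
      unfolding powr_mult power_half_powr_sdim by simp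
    finally show ?thesis .
  qed
  then show ?thesis unfolding eventually_sequentially by blast
qed

section \<open>Lower bound for the centred Hausdorff measure\<close>

lemma C_inf_le_cover_sum:
  assumes k: "k \<ge> 4" and cover: "(x, d) \<in> centred_coverings (1/2) gasket"
  shows "ennreal (C_inf k) \<le> (\<Sum>i. ennreal ((2 * d i) powr sdim))"
proof (cases "(\<Sum>i. ennreal ((2 * d i) powr sdim))")
  case (real r)
  have x: "x i \<in> gasket" and d: "0 < d i" "2 * d i \<le> 1/2" for i
    using cover unfolding centred_coverings_def by blast+
  have cov: "gasket \<subseteq> (\<Union>i. cball (x i) (d i))" using cover by (auto simp: centred_coverings_def)
  \<comment> \<open>Slightly enlarged balls are open and admit a finite subcover, so one level
    \<open>n\<close> serves all of them and subadditivity of the content applies.\<close>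
  have "C_inf k \<le> (1 + \<epsilon>) powr sdim * r" if \<epsilon>: "0 < \<epsilon>" "\<epsilon> < 1" for \<epsilon>
  proof -
    let ?e = "\<lambda>i. (1 + \<epsilon>) * d i"
    have "gasket \<subseteq> (\<Union>i. ball (x i) (?e i))"
    proof
      fix y assume "y \<in> gasket"
      then obtain i where "dist (x i) y \<le> d i" using cov by auto
      also have "d i < ?e i" using d[of i] \<epsilon> by simp
      finally show "y \<in> (\<Union>i. ball (x i) (?e i))" by auto
    qed
    then obtain I where I: "finite I" "gasket \<subseteq> (\<Union>i\<in>I. ball (x i) (?e i))"
      using compactE_image[OF gasket_props(1), of UNIV "\<lambda>i. ball (x i) (?e i)"] by auto
    have "0 < ?e i" "?e i < sqrt 3 / 2" for i
    proof -
      show "0 < ?e i" using d[of i] \<epsilon> by simp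
      \<comment> \<open>The diameter bound \<open>1/2\<close> on the covering balls keeps even the
        enlarged radii in the range of the density bound.\<close>
      have "?e i \<le> 2 * (1/4)" using d[of i] \<epsilon> by (intro mult_mono) auto
      then show "?e i < sqrt 3 / 2" using sqrt3_bounds by simp
    qed
    then have "\<forall>\<^sub>F n in sequentially. \<forall>i\<in>I.
        C_inf k * content n (cball (x i) (?e i)) \<le> (2 * ?e i) powr sdim"
      using I(1) x by (intro eventually_ball_finite ballI density_bound[OF k]) auto
    from eventually_happens'[OF sequentially_bot this] obtain n where n:
      "\<And>i. i \<in> I \<Longrightarrow> C_inf k * content n (cball (x i) (?e i)) \<le> (2 * ?e i) powr sdim"
      by blast
    have "(\<Union>i\<in>I. ball (x i) (?e i)) \<subseteq> (\<Union>i\<in>I. cball (x i) (?e i))"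
      by (intro UN_mono ball_subset_cball) auto
    then have "content n gasket \<le> content n (\<Union>i\<in>I. cball (x i) (?e i))"
      using I(2) by (intro content_mono) blast
    also have "\<dots> \<le> (\<Sum>i\<in>I. content n (cball (x i) (?e i)))" by (rule content_UN_le[OF I(1)])
    finally have "C_inf k * content n gasket \<le> C_inf k * (\<Sum>i\<in>I. content n (cball (x i) (?e i)))"
      using C_nonneg[OF k] K_pos[of k] by (intro mult_left_mono) (auto simp: C_inf_def)
    also have "\<dots> \<le> (\<Sum>i\<in>I. (2 * ?e i) powr sdim)"
      unfolding sum_distrib_left by (intro sum_mono n)
    also have "\<dots> = (1 + \<epsilon>) powr sdim * (\<Sum>i\<in>I. (2 * d i) powr sdim)"
      by (simp only: mult.left_commute[of 2] powr_mult[of "1 + \<epsilon>"] sum_distrib_left)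
    also have "\<dots> \<le> (1 + \<epsilon>) powr sdim * r"
    proof (rule mult_left_mono)
      have "ennreal (\<Sum>i\<in>I. (2 * d i) powr sdim) = (\<Sum>i\<in>I. ennreal ((2 * d i) powr sdim))"
        by (simp add: sum_ennreal)
      also have "\<dots> \<le> ennreal r"
        unfolding real(2)[symmetric] using I(1) by (intro sum_le_suminf) auto
      finally show "(\<Sum>i\<in>I. (2 * d i) powr sdim) \<le> r" using real(1) by simp
    qed simp
    finally show ?thesis by (simp add: content_gasket)
  qed
  then have "\<forall>\<^sub>F \<epsilon> in at_right 0. C_inf k \<le> (1 + \<epsilon>) powr sdim * r"
    unfolding eventually_at_right_field by (intro exI[of _ 1]) auto
  moreover have "((\<lambda>\<epsilon>. (1 + \<epsilon>) powr sdim * r) \<longlongrightarrow> (1 + 0) powr sdim * r) (at_right 0)"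
    by (intro tendsto_intros) auto
  ultimately have "C_inf k \<le> (1 + 0) powr sdim * r"
    by (intro tendsto_lowerbound) auto
  then show ?thesis unfolding real(2) by (simp add: ennreal_leI)
qed simp

text \<open>The gasket is a closed subset of itself, and any single \<delta> bounds its premeasure
  from below.\<close>

lemma C_inf_le_centred_hausdorff:
  assumes "k \<ge> 4"
  shows "ennreal (C_inf k) \<le> centred_hausdorff sdim gasket"
proof -
  have "ennreal (C_inf k) \<le> centred_inf sdim (1/2) gasket"
    unfolding centred_inf_def using C_inf_le_cover_sum[OF assms] by (intro INF_greatest) auto
  also have "\<dots> \<le> centred_premeasure sdim gasket"
    unfolding centred_premeasure_eq_SUP[OF gasket_props(2)] by (intro SUP_upper) auto
  also have "\<dots> \<le> centred_hausdorff sdim gasket"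
    unfolding centred_hausdorff_def
    using compact_imp_closed[OF gasket_props(1)] by (intro SUP_upper) auto
  finally show ?thesis .
qed

section \<open>Finite centred coverings\<close>

text \<open>Finite coverings of \<open>X \<inter> Y\<close> with centres anywhere in
  \<open>Y\<close>. Lists make costs add under concatenation, repetitions included.\<close>

definition coverable :: "(real^2) set \<Rightarrow> real \<Rightarrow> (real^2) set \<Rightarrow> real \<Rightarrow> bool" where
  "coverable Y \<delta> X c \<longleftrightarrow> (\<exists>L. (\<forall>(x, d)\<in>set L. x \<in> Y \<and> 0 < d \<and> 2 * d \<le> \<delta>)
     \<and> X \<inter> Y \<subseteq> (\<Union>(x, d)\<in>set L. cball x d) \<and> (\<Sum>(x, d)\<leftarrow>L. (2 * d) powr sdim) \<le> c)"

lemma coverable_disjoint: "X \<inter> Y = {} \<Longrightarrow> 0 \<le> c \<Longrightarrow> coverable Y \<delta> X c"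
  unfolding coverable_def by (intro exI[of _ "[]"]) auto

lemma coverable_ball:
  assumes "x \<in> Y" "0 < d" "2 * d \<le> \<delta>" "X \<inter> Y \<subseteq> cball x d" "(2 * d) powr sdim \<le> c"
  shows "coverable Y \<delta> X c"
  unfolding coverable_def using assms by (intro exI[of _ "[(x, d)]"]) auto

lemma coverable_mono: "coverable Y \<delta> X c \<Longrightarrow> X' \<subseteq> X \<Longrightarrow> c \<le> c' \<Longrightarrow> coverable Y \<delta> X' c'"
  unfolding coverable_def by (meson Int_mono order_refl order_trans)

lemma coverable_Un:
  assumes "coverable Y \<delta> X c" "coverable Y \<delta> X' c'"
  shows "coverable Y \<delta> (X \<union> X') (c + c')"
proof -
  obtain L where L: "\<forall>(x, d)\<in>set L. x \<in> Y \<and> 0 < d \<and> 2 * d \<le> \<delta>"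
    "X \<inter> Y \<subseteq> (\<Union>(x, d)\<in>set L. cball x d)" "(\<Sum>(x, d)\<leftarrow>L. (2 * d) powr sdim) \<le> c"
    using assms(1) unfolding coverable_def by blast
  obtain L' where L': "\<forall>(x, d)\<in>set L'. x \<in> Y \<and> 0 < d \<and> 2 * d \<le> \<delta>"
    "X' \<inter> Y \<subseteq> (\<Union>(x, d)\<in>set L'. cball x d)" "(\<Sum>(x, d)\<leftarrow>L'. (2 * d) powr sdim) \<le> c'"
    using assms(2) unfolding coverable_def by blast
  have "(X \<union> X') \<inter> Y \<subseteq> (\<Union>(x, d)\<in>set (L @ L'). cball x d)"
    using L(2) L'(2) unfolding set_append UN_Un by blast
  moreover have "\<forall>(x, d)\<in>set (L @ L'). x \<in> Y \<and> 0 < d \<and> 2 * d \<le> \<delta>"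
    using L(1) L'(1) by auto
  moreover have "(\<Sum>(x, d)\<leftarrow>L @ L'. (2 * d) powr sdim) \<le> c + c'" using L(3) L'(3) by simp
  ultimately show ?thesis unfolding coverable_def by blast
qed

lemma coverable_UN:
  assumes "finite I" "\<And>i. i \<in> I \<Longrightarrow> coverable Y \<delta> (X i) (c i)"
  shows "coverable Y \<delta> (\<Union>i\<in>I. X i) (\<Sum>i\<in>I. c i)"
  using assms
proof (induction I)
  case (insert i I)
  then have "coverable Y \<delta> (X i \<union> (\<Union>i\<in>I. X i)) (c i + (\<Sum>i\<in>I. c i))"
    by (intro coverable_Un) auto
  with insert show ?case by simp
qed (simp add: coverable_disjoint)

text \<open>A finite list is padded to a sequence by balls about one point of \<open>Y\<close> with
  geometrically shrinking radii, at arbitrarily small total cost.\<close>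

lemma centred_inf_le_coverable:
  assumes Y: "Y \<noteq> {}" "Y \<subseteq> X" and \<delta>: "0 < \<delta>" and cov: "coverable Y \<delta> X c"
  shows "centred_inf sdim \<delta> Y \<le> ennreal c"
proof (rule ennreal_le_epsilon)
  fix e :: real assume e: "0 < e"
  obtain L where L: "\<And>x d. (x, d) \<in> set L \<Longrightarrow> x \<in> Y \<and> 0 < d \<and> 2 * d \<le> \<delta>"
    "X \<inter> Y \<subseteq> (\<Union>(x, d)\<in>set L. cball x d)" "(\<Sum>(x, d)\<leftarrow>L. (2 * d) powr sdim) \<le> c"
    using cov unfolding coverable_def by blast
  obtain y where y: "y \<in> Y" using Y by blast
  \<comment> \<open>The first term respects \<delta>; the second bounds the cost of a ball of radius
    \<open>r\<close> by \<open>e / 2\<close>, and the geometric series adds the factor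
    \<open>3 / 2\<close>.\<close>
  define r where "r = min (\<delta> / 2) ((e / 2) powr (1 / sdim) / 2)"
  have r: "0 < r" "2 * r \<le> \<delta>" using \<delta> e by (auto simp: r_def)
  have "(2 * r) powr sdim \<le> ((e / 2) powr (1 / sdim)) powr sdim"
    using r sdim_pos by (intro powr_mono2) (auto simp: r_def)
  also have "\<dots> = e / 2" using e sdim_pos by (simp add: powr_powr)
  finally have r_cost: "(2 * r) powr sdim \<le> e / 2" .
  define x where "x i = (if i < length L then fst (L ! i) else y)" for i
  define d where "d i = (if i < length L then snd (L ! i) else r * (1/2) ^ i)" for i
  have scaled: "(2 * (r * (1/2) ^ i)) powr sdim = (2 * r) powr sdim * (1/3) ^ i" for i
    unfolding mult.assoc[symmetric] powr_mult[of "2 * r"] power_half_powr_sdim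
    by (simp add: power_one_over)
  have "(x, d) \<in> centred_coverings \<delta> Y"
    unfolding centred_coverings_def
  proof (clarify, intro conjI allI)
    fix i
    have "x i \<in> Y \<and> 0 < d i \<and> 2 * d i \<le> \<delta>"
    proof (cases "i < length L")
      case True
      then show ?thesis using L(1)[of "fst (L ! i)" "snd (L ! i)"] by (simp add: x_def d_def)
    next
      case False
      have "r * (1/2) ^ i \<le> r * 1" using r by (intro mult_left_mono power_le_one) auto
      then have "2 * (r * (1/2) ^ i) \<le> \<delta>" using r by linarith
      with False show ?thesis using y r by (simp add: x_def d_def)
    qed
    then show "x i \<in> Y" "0 < d i" "2 * d i \<le> \<delta>" by auto
  next
    show "Y \<subseteq> (\<Union>i. cball (x i) (d i))"
    proof
      fix u assume "u \<in> Y"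
      with L(2) Y(2) obtain p where p: "p \<in> set L" "u \<in> cball (fst p) (snd p)" by fastforce
      then obtain i where "i < length L" "L ! i = p" by (auto simp: in_set_conv_nth)
      with p(2) show "u \<in> (\<Union>i. cball (x i) (d i))"
        by (intro UN_I[of i]) (auto simp: x_def d_def)
    qed
  qed
  then have "centred_inf sdim \<delta> Y \<le> (\<Sum>i. ennreal ((2 * d i) powr sdim))"
    unfolding centred_inf_def by (intro INF_lower2[of "(x, d)"]) auto
  also have "\<dots> \<le> (\<Sum>i. ennreal (if i < length L then (2 * snd (L ! i)) powr sdim else 0)
      + ennreal ((2 * r) powr sdim * (1/3) ^ i))"
  proof (intro suminf_le summableI)
    fix i
    show "ennreal ((2 * d i) powr sdim)
      \<le> ennreal (if i < length L then (2 * snd (L ! i)) powr sdim else 0)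
        + ennreal ((2 * r) powr sdim * (1/3) ^ i)"
      using scaled[of i] by (simp add: d_def)
  qed
  also have "\<dots> = (\<Sum>i. ennreal (if i < length L then (2 * snd (L ! i)) powr sdim else 0))
      + (\<Sum>i. ennreal ((2 * r) powr sdim * (1/3) ^ i))"
    by (intro suminf_add[symmetric] summableI)
  also have "(\<Sum>i. ennreal (if i < length L then (2 * snd (L ! i)) powr sdim else 0))
      = (\<Sum>i<length L. ennreal ((2 * snd (L ! i)) powr sdim))"
    by (subst suminf_finite[of "{..<length L}"]) auto
  also have "\<dots> = ennreal (\<Sum>(x, d)\<leftarrow>L. (2 * d) powr sdim)"
    by (simp add: sum_ennreal sum_list_sum_nth atLeast0LessThan case_prod_unfold)
  also have "\<dots> \<le> ennreal c" using L(3) by (rule ennreal_leI)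
  also have "(\<Sum>i. ennreal ((2 * r) powr sdim * (1/3) ^ i)) = ennreal ((2 * r) powr sdim * (3 / 2))"
    using sums_mult[OF geometric_sums[of "1/3 :: real"], of "(2 * r) powr sdim"]
    by (intro sums_unique[symmetric] sums_ennreal[THEN iffD2]) auto
  also have "\<dots> \<le> ennreal e" using r_cost e by (intro ennreal_leI) simp
  finally show "centred_inf sdim \<delta> Y \<le> ennreal c + ennreal e" by (simp add: add_mono)
qed

section \<open>Covering cells by balls centred in \<open>Y\<close>\<close>

lemma coverable_cell:
  assumes w: "w \<in> words n" and n: "4 * (1/2) ^ n \<le> \<delta>"
  shows "coverable Y \<delta> (cell w) (9 / 3 ^ n)"
proof (cases "cell w \<inter> Y = {}")
  case False
  then obtain y where y: "y \<in> cell w" "y \<in> Y" by blast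
  show ?thesis
  proof (rule coverable_ball)
    show "cell w \<inter> Y \<subseteq> cball y (2 * (1/2) ^ n)"
      using dist_cell_le[OF y(1)] length_words[OF w] by auto
    \<comment> \<open>The radius is the diameter bound for cells, so the 9 in the cost is
      \<open>4 powr sdim\<close>.\<close>
    have "(4::real) powr sdim = 9"
      using powr_mult[of 2 2 sdim] by (simp add: two_powr_sdim)
    moreover have "2 * (2 * (1/2) ^ n) = 4 * (1/2 :: real) ^ n" by simp
    ultimately show "(2 * (2 * (1/2) ^ n)) powr sdim \<le> 9 / 3 ^ n"
      by (simp only: powr_mult[of 4] power_half_powr_sdim)
  qed (use y n in auto)
qed (simp add: coverable_disjoint)

text \<open>A cell meeting \<open>Y\<close> is not deficient if all its descendants \<open>p\<close> levels below meet \<open>Y\<close>; then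
  \<open>Y\<close> comes close to every point of the cell, and a ball can be recentred at a point of \<open>Y\<close>.\<close>

definition deficient :: "nat \<Rightarrow> (real^2) set \<Rightarrow> nat \<Rightarrow> nat list set" where
  "deficient p Y n = {w \<in> meeting n Y. \<exists>u\<in>words p. cell (w @ u) \<inter> Y = {}}"

text \<open>Each deficient word has a descendant missing \<open>Y\<close>. These descendants and the
  words of level \<open>n + p\<close> meeting \<open>Y\<close> form disjoint sets of extensions of
  words in \<open>meeting n Y\<close>, and each word has \<open>3 ^ p\<close> extensions.\<close>

lemma card_deficient_le:
  "card (deficient p Y n) / 3 ^ n \<le> 3 ^ p * (content n Y - content (n + p) Y)"
proof -
  have "\<forall>w\<in>deficient p Y n. \<exists>u\<in>words p. cell (w @ u) \<inter> Y = {}" by (auto simp: deficient_def)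
  then obtain g where g: "\<And>w. w \<in> deficient p Y n \<Longrightarrow> g w \<in> words p \<and> cell (w @ g w) \<inter> Y = {}"
    by metis
  define A where "A = (\<lambda>w. w @ g w) ` deficient p Y n"
  have len: "length w = n" if "w \<in> deficient p Y n" for w
    using that by (auto simp: deficient_def meeting_def words_def)
  have sub: "deficient p Y n \<subseteq> meeting n Y" by (auto simp: deficient_def)
  have fin: "finite A" unfolding A_def using finite_subset[OF sub] by simp
  have "card A = card (deficient p Y n)"
    unfolding A_def by (rule card_image) (auto simp: inj_on_def len)
  moreover have "A \<inter> meeting (n + p) Y = {}" using g by (auto simp: A_def meeting_def)
  then have "card (A \<union> meeting (n + p) Y) = card A + card (meeting (n + p) Y)"
    using fin by (intro card_Un_disjoint) auto
  moreover have "A \<union> meeting (n + p) Y \<subseteq> (\<lambda>(u, w). u @ w) ` (meeting n Y \<times> words p)"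
  proof
    fix v assume "v \<in> A \<union> meeting (n + p) Y"
    then show "v \<in> (\<lambda>(u, w). u @ w) ` (meeting n Y \<times> words p)"
    proof
      assume "v \<in> A"
      then obtain w where "w \<in> deficient p Y n" "v = w @ g w" by (auto simp: A_def)
      with g sub show ?thesis by (intro image_eqI[of _ _ "(w, g w)"]) auto
    next
      assume v: "v \<in> meeting (n + p) Y"
      then have "v \<in> words (n + p)" by (simp add: meeting_def)
      then obtain u w where uw: "v = u @ w" "u \<in> words n" "w \<in> words p"
        unfolding words_add by auto
      then have "u \<in> meeting n Y"
        using v cell_append_subset[OF uw(3), of u] by (auto simp: meeting_def)
      with uw show ?thesis by (intro image_eqI[of _ _ "(u, w)"]) auto
    qed
  qed
  then have "card (A \<union> meeting (n + p) Y) \<le> card (meeting n Y \<times> words p)"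
    using finite_words by (intro surj_card_le) auto
  ultimately have "card (deficient p Y n) + card (meeting (n + p) Y) \<le> card (meeting n Y) * 3 ^ p"
    by (simp add: card_cartesian_product card_words)
  then have "real (card (deficient p Y n) + card (meeting (n + p) Y))
      \<le> real (card (meeting n Y) * 3 ^ p)"
    by (rule of_nat_mono)
  then have "card (deficient p Y n) / 3 ^ n
      \<le> (real (card (meeting n Y)) * 3 ^ p - real (card (meeting (n + p) Y))) / 3 ^ n"
    by (intro divide_right_mono) auto
  also have "\<dots> = 3 ^ p * (content n Y - content (n + p) Y)"
    by (simp add: content_def field_simps power_add)
  finally show ?thesis .
qed

text \<open>\<open>content n Y\<close> is decreasing and nonnegative, so its drop over
  \<open>p\<close> levels tends to zero.\<close>

lemma deficient_tendsto_0: "(\<lambda>n. card (deficient p Y n) / 3 ^ n) \<longlonglongrightarrow> 0"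
proof (rule tendsto_sandwich[OF _ _ tendsto_const])
  have "decseq (\<lambda>n. content n Y)" by (auto simp: decseq_def intro: content_antimono)
  then obtain L where L: "(\<lambda>n. content n Y) \<longlonglongrightarrow> L"
    by (rule decseq_convergent[of _ 0]) auto
  have "(\<lambda>n. 3 ^ p * (content n Y - content (n + p) Y)) \<longlonglongrightarrow> 3 ^ p * (L - L)"
    by (intro tendsto_intros L LIMSEQ_ignore_initial_segment)
  then show "(\<lambda>n. 3 ^ p * (content n Y - content (n + p) Y)) \<longlonglongrightarrow> 0" by simp
qed (auto intro!: always_eventually card_deficient_le)

text \<open>\<open>x\<close> lies in a cell of level \<open>p\<close>, and \<open>Y\<close> meets
  the copy of that cell inside \<open>cell w\<close>. A point of \<open>Y\<close> there serves as
  centre once the radius, before scaling, is enlarged by the diameter bound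
  \<open>2 * (1/2) ^ p\<close>.\<close>

lemma coverable_full_cell:
  assumes x: "x \<in> gasket" and d: "0 < d" and w: "w \<in> meeting n Y - deficient p Y n"
    and n: "2 * (d + 2 * (1/2) ^ p) * (1/2) ^ n \<le> \<delta>"
  shows "coverable Y \<delta> (\<Union>u\<in>{u \<in> words k. cell u \<subseteq> cball x d}. cell (w @ u))
    ((2 * (d + 2 * (1/2) ^ p)) powr sdim / 3 ^ n)"
proof -
  obtain u0 where u0: "u0 \<in> words p" "x \<in> cell u0" using x gasket_eq_UN_cells[of p] by blast
  then have "cell (w @ u0) \<inter> Y \<noteq> {}" using w by (auto simp: deficient_def)
  then obtain y0 where y0: "y0 \<in> cell u0" "fw w y0 \<in> Y" by (auto simp: cell_append)
  have y0x: "dist y0 x \<le> 2 * (1/2) ^ p"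
    using dist_cell_le[OF y0(1) u0(2)] length_words[OF u0(1)] by simp
  have len: "length w = n" using w by (auto simp: meeting_def words_def)
  have pos: "0 < d + 2 * (1/2) ^ p" using d by (simp add: add_pos_pos)
  show ?thesis
  proof (rule coverable_ball[OF y0(2)])
    show "(\<Union>u\<in>{u \<in> words k. cell u \<subseteq> cball x d}. cell (w @ u)) \<inter> Y
        \<subseteq> cball (fw w y0) ((d + 2 * (1/2) ^ p) * (1/2) ^ n)"
    proof
      fix t assume "t \<in> (\<Union>u\<in>{u \<in> words k. cell u \<subseteq> cball x d}. cell (w @ u)) \<inter> Y"
      then obtain t0 where t: "t = fw w t0" "t0 \<in> cball x d" by (auto simp: cell_append)
      have "dist y0 t0 \<le> d + 2 * (1/2) ^ p"
        using t(2) y0x dist_triangle[of y0 t0 x] by simp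
      then show "t \<in> cball (fw w y0) ((d + 2 * (1/2) ^ p) * (1/2) ^ n)"
        by (simp add: t(1) dist_fw len mult_right_mono)
    qed
    show "(2 * ((d + 2 * (1/2) ^ p) * (1/2) ^ n)) powr sdim
        \<le> (2 * (d + 2 * (1/2) ^ p)) powr sdim / 3 ^ n"
      unfolding mult.assoc[symmetric] powr_mult[of _ "(1/2) ^ n"] power_half_powr_sdim by simp
    show "2 * ((d + 2 * (1/2) ^ p) * (1/2) ^ n) \<le> \<delta>" using n by (simp only: mult.assoc)
  qed (use pos in simp)
qed

text \<open>In one round, deficient cells (\<open>R1\<close>) are covered singly at cost
  \<open>9 * \<epsilon>\<close>; in each other cell (\<open>R2\<close>) a scaled ball covers the
  fraction \<open>a\<close> of the descendants \<open>k\<close> levels below, and the induction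
  hypothesis treats the rest (\<open>R'\<close>). The main cost \<open>D / a\<close> is the fixed
  point of \<open>c = D + (1 - a) * c\<close>.\<close>

lemma coverable_iterate:
  fixes p k :: nat and x :: "real^2" and d :: real
  defines "D \<equiv> (2 * (d + 2 * (1/2) ^ p)) powr sdim"
    and "G \<equiv> {u \<in> words k. cell u \<subseteq> cball x d}"
  defines "a \<equiv> card G / 3 ^ k"
  assumes x: "x \<in> gasket" and d: "0 < d" and a: "0 < a"
    and N: "\<And>n. n \<ge> N \<Longrightarrow> card (deficient p Y n) / 3 ^ n \<le> \<epsilon>"
      "\<And>n. n \<ge> N \<Longrightarrow> 4 * (1/2) ^ n \<le> \<delta>" "\<And>n. n \<ge> N \<Longrightarrow> 2 * (d + 2 * (1/2) ^ p) * (1/2) ^ n \<le> \<delta>"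
  shows "n \<ge> N \<Longrightarrow> R \<subseteq> words n \<Longrightarrow> coverable Y \<delta> (\<Union>w\<in>R. cell w)
    ((D / a + 9 * (1 - a) ^ m) * (card R / 3 ^ n) + 9 * real m * \<epsilon>)"
proof (induction m arbitrary: n R)
  case 0
  have "finite R" using 0 finite_words finite_subset by blast
  then have "coverable Y \<delta> (\<Union>w\<in>R. cell w) (\<Sum>w\<in>R. 9 / 3 ^ n)"
    using 0 N(2) by (intro coverable_UN coverable_cell) auto
  moreover have "(\<Sum>w\<in>R. 9 / 3 ^ n) \<le> (D / a + 9) * (card R / 3 ^ n)"
    using a by (simp add: D_def divide_right_mono mult_right_mono ring_distribs)
  ultimately show ?case by (auto intro: coverable_mono)
next
  case (Suc m)
  have GW: "G \<subseteq> words k" by (auto simp: G_def)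
  then have fG: "finite G" using finite_words finite_subset by blast
  have "card G \<le> 3 ^ k" using card_mono[OF finite_words GW] by (simp add: card_words)
  then have "real (card G) \<le> real (3 ^ k)" by (rule of_nat_mono)
  then have a1: "a \<le> 1" by (simp add: a_def)
  have fR: "finite R" using Suc.prems finite_words finite_subset by blast
  define R1 where "R1 = R \<inter> deficient p Y n"
  define R2 where "R2 = R - deficient p Y n"
  define R' where "R' = (\<lambda>(u, w). u @ w) ` (R2 \<times> (words k - G))"
  have f12: "finite R1" "finite R2" using fR by (auto simp: R1_def R2_def)
  have "card R1 \<le> card (deficient p Y n)"
    unfolding R1_def by (intro card_mono) (auto intro: finite_subset[OF _ finite_meeting] simp: deficient_def)
  then have R1: "card R1 / 3 ^ n \<le> \<epsilon>"
    using N(1)[OF Suc.prems(1)] by (meson divide_right_mono of_nat_le_iff order_trans zero_le_numeral zero_le_power)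
  have R2: "card R2 / 3 ^ n \<le> card R / 3 ^ n"
    unfolding R2_def using fR by (intro divide_right_mono of_nat_mono card_mono) auto
  have "coverable Y \<delta> (\<Union>w\<in>R1. cell w) (\<Sum>w\<in>R1. 9 / 3 ^ n)"
    using f12 Suc.prems N(2) by (intro coverable_UN coverable_cell) (auto simp: R1_def)
  then have c1: "coverable Y \<delta> (\<Union>w\<in>R1. cell w) (9 * \<epsilon>)"
    by (rule coverable_mono) (use mult_left_mono[OF R1, of 9] in \<open>simp_all add: mult.commute\<close>)
  have "coverable Y \<delta> (\<Union>w\<in>R2. \<Union>u\<in>G. cell (w @ u)) (\<Sum>w\<in>R2. D / 3 ^ n)"
  proof (intro coverable_UN f12)
    fix w assume w: "w \<in> R2"
    show "coverable Y \<delta> (\<Union>u\<in>G. cell (w @ u)) (D / 3 ^ n)"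
    proof (cases "w \<in> meeting n Y")
      case True
      then show ?thesis unfolding D_def G_def
        using w Suc.prems by (intro coverable_full_cell x d N(3)) (auto simp: R2_def)
    next
      case False
      then have "cell w \<inter> Y = {}" using w Suc.prems(2) by (auto simp: R2_def meeting_def)
      moreover have "cell (w @ u) \<subseteq> cell w" if "u \<in> G" for u
        using that GW by (intro cell_append_subset) auto
      ultimately show ?thesis by (intro coverable_disjoint) (auto simp: D_def)
    qed
  qed
  then have c2: "coverable Y \<delta> (\<Union>w\<in>R2. \<Union>u\<in>G. cell (w @ u)) (D * (card R / 3 ^ n))"
    by (rule coverable_mono) (use mult_left_mono[OF R2, of D] in \<open>auto simp: D_def mult_ac\<close>)
  have R'_words: "R' \<subseteq> words (n + k)"
    unfolding R'_def words_add using Suc.prems(2) by (intro image_mono) (auto simp: R2_def)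
  have "card R' = card (R2 \<times> (words k - G))"
    unfolding R'_def using Suc.prems(2)
    by (intro card_image inj_on_subset[OF inj_on_append[of n]]) (auto simp: R2_def)
  then have "real (card R') = real (card R2) * (3 ^ k - real (card G))"
    using fG GW \<open>card G \<le> 3 ^ k\<close> by (simp add: card_cartesian_product card_Diff_subset card_words of_nat_diff)
  then have "card R' / 3 ^ (n + k) = card R2 / 3 ^ n * (1 - a)"
    by (simp add: a_def field_simps power_add)
  also have "\<dots> \<le> card R / 3 ^ n * (1 - a)" using R2 a1 by (intro mult_right_mono) auto
  finally have R': "card R' / 3 ^ (n + k) \<le> card R / 3 ^ n * (1 - a)" .
  have nonneg: "0 \<le> D / a + 9 * (1 - a) ^ m" using a a1 by (simp add: D_def)
  have "coverable Y \<delta> (\<Union>w\<in>R'. cell w)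
      ((D / a + 9 * (1 - a) ^ m) * (card R' / 3 ^ (n + k)) + 9 * real m * \<epsilon>)"
    using Suc.prems(1) R'_words by (intro Suc.IH) auto
  then have c3: "coverable Y \<delta> (\<Union>w\<in>R'. cell w)
      ((D / a + 9 * (1 - a) ^ m) * (card R / 3 ^ n * (1 - a)) + 9 * real m * \<epsilon>)"
    by (rule coverable_mono[OF _ subset_refl add_right_mono[OF mult_left_mono[OF R' nonneg]]])
  have "(\<Union>w\<in>R. cell w)
      \<subseteq> (\<Union>w\<in>R1. cell w) \<union> ((\<Union>w\<in>R2. \<Union>u\<in>G. cell (w @ u)) \<union> (\<Union>w\<in>R'. cell w))"
  proof
    fix t assume "t \<in> (\<Union>w\<in>R. cell w)"
    then obtain w where w: "w \<in> R" "t \<in> cell w" by blast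
    then obtain u where u: "u \<in> words k" "t \<in> cell (w @ u)" using cell_eq_UN_cells[of w k] by blast
    show "t \<in> (\<Union>w\<in>R1. cell w) \<union> ((\<Union>w\<in>R2. \<Union>u\<in>G. cell (w @ u)) \<union> (\<Union>w\<in>R'. cell w))"
    proof (cases "w \<in> R1 \<or> u \<in> G")
      case True
      with w u show ?thesis by (auto simp: R1_def R2_def)
    next
      case False
      then have "w @ u \<in> R'"
        unfolding R'_def using w u by (intro image_eqI[of _ _ "(w, u)"]) (auto simp: R1_def R2_def)
      with u show ?thesis by blast
    qed
  qed
  moreover have "9 * \<epsilon> + (D * (card R / 3 ^ n)
      + ((D / a + 9 * (1 - a) ^ m) * (card R / 3 ^ n * (1 - a)) + 9 * real m * \<epsilon>))
    = (D / a + 9 * (1 - a) ^ Suc m) * (card R / 3 ^ n) + 9 * real (Suc m) * \<epsilon>"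
    using a by (simp add: field_simps)
  ultimately show ?case
    using coverable_mono[OF coverable_Un[OF c1 coverable_Un[OF c2 c3]]] by simp
qed

section \<open>Upper bound for the centred Hausdorff measure\<close>

lemma centred_inf_le:
  assumes Y: "Y \<subseteq> gasket" "Y \<noteq> {}" and x: "x \<in> gasket" and d: "0 < d" and \<delta>: "0 < \<delta>"
    and a: "a = card {u \<in> words k. cell u \<subseteq> cball x d} / 3 ^ k" "0 < a"
  shows "centred_inf sdim \<delta> Y \<le> ennreal ((2 * d) powr sdim / a)"
proof -
  \<comment> \<open>\<open>m\<close> is at once the recentring depth, the number of rounds and the
    precision, so all error terms vanish together.\<close>
  define c where "c m = (2 * (d + 2 * (1/2) ^ m)) powr sdim / a + 9 * (1 - a) ^ m + 9 * (1/2) ^ m" for m :: nat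
  have "centred_inf sdim \<delta> Y \<le> ennreal (c m)" for m
  proof -
    \<comment> \<open>The divisor keeps the error accumulated over \<open>m\<close> rounds at most
      \<open>9 * (1/2) ^ m\<close>.\<close>
    define \<epsilon> where "\<epsilon> = (1/2) ^ m / (real m + 1)"
    have \<epsilon>: "0 < \<epsilon>" by (simp add: \<epsilon>_def)
    have small: "\<forall>\<^sub>F n in sequentially. b * (1/2) ^ n \<le> \<delta>" for b :: real
    proof -
      have "(\<lambda>n. b * (1/2) ^ n) \<longlonglongrightarrow> b * 0" by (intro tendsto_intros LIMSEQ_power_zero) simp
      then have "\<forall>\<^sub>F n in sequentially. b * (1/2) ^ n < \<delta>"
        using \<delta> by (intro order_tendstoD(2)[of _ 0]) auto
      then show ?thesis by eventually_elim simp
    qed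
    have "\<forall>\<^sub>F n in sequentially. card (deficient m Y n) / 3 ^ n \<le> \<epsilon> \<and> 4 * (1/2) ^ n \<le> \<delta>
        \<and> 2 * (d + 2 * (1/2) ^ m) * (1/2) ^ n \<le> \<delta>"
      using order_tendstoD(2)[OF deficient_tendsto_0 \<epsilon>, of m Y]
      by (intro eventually_conj small) (auto elim: eventually_mono)
    then obtain N where N: "\<And>n. n \<ge> N \<Longrightarrow> card (deficient m Y n) / 3 ^ n \<le> \<epsilon>"
        "\<And>n. n \<ge> N \<Longrightarrow> 4 * (1/2) ^ n \<le> \<delta>" "\<And>n. n \<ge> N \<Longrightarrow> 2 * (d + 2 * (1/2) ^ m) * (1/2) ^ n \<le> \<delta>"
      unfolding eventually_sequentially by auto
    have "coverable Y \<delta> (\<Union>w\<in>words N. cell w)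
      (((2 * (d + 2 * (1/2) ^ m)) powr sdim / a + 9 * (1 - a) ^ m) * (card (words N) / 3 ^ N) + 9 * real m * \<epsilon>)"
      unfolding a(1)
      by (rule coverable_iterate[OF x d a(2)[unfolded a(1)] N order_refl subset_refl])
    then have "coverable Y \<delta> gasket (c m)"
    proof (rule coverable_mono)
      have "real m * \<epsilon> \<le> (real m + 1) * \<epsilon>" using \<epsilon> by (intro mult_right_mono) auto
      also have "\<dots> = (1/2) ^ m" by (simp add: \<epsilon>_def)
      finally have "real m * \<epsilon> \<le> (1/2) ^ m" .
      then show "((2 * (d + 2 * (1/2) ^ m)) powr sdim / a + 9 * (1 - a) ^ m) * (card (words N) / 3 ^ N)
          + 9 * real m * \<epsilon> \<le> c m"
        by (simp add: c_def card_words)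
    qed (use gasket_eq_UN_cells in auto)
    then show ?thesis using Y \<delta> by (intro centred_inf_le_coverable) auto
  qed
  moreover have "c \<longlonglongrightarrow> (2 * (d + 2 * 0)) powr sdim / a + 9 * 0 + 9 * 0"
  proof -
    have "card {u \<in> words k. cell u \<subseteq> cball x d} \<le> card (words k)"
      using finite_words by (intro card_mono) auto
    then have "real (card {u \<in> words k. cell u \<subseteq> cball x d}) \<le> real (3 ^ k)"
      unfolding card_words by (rule of_nat_mono)
    then have "a \<le> 1" by (simp add: a(1))
    then show ?thesis unfolding c_def
      using a(2) d by (intro tendsto_intros LIMSEQ_power_zero) auto
  qed
  then have "(\<lambda>m. ennreal (c m)) \<longlonglongrightarrow> ennreal ((2 * d) powr sdim / a)"
    by (intro tendsto_ennrealI) simp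
  ultimately show ?thesis by (intro LIMSEQ_le_const) auto
qed

text \<open>The bound of \<open>centred_inf_le\<close> depends neither on \<delta> nor on
  \<open>Y\<close>, so it passes to both suprema.\<close>

lemma centred_hausdorff_le:
  assumes x: "x \<in> gasket" and d: "0 < d"
    and a: "a = card {u \<in> words k. cell u \<subseteq> cball x d} / 3 ^ k" "0 < a"
  shows "centred_hausdorff sdim gasket \<le> ennreal ((2 * d) powr sdim / a)"
  unfolding centred_hausdorff_def
proof (rule SUP_least)
  fix Y assume "Y \<in> {Y. Y \<subseteq> gasket \<and> closed Y}"
  then have "Y \<subseteq> gasket" by simp
  then show "centred_premeasure sdim Y \<le> ennreal ((2 * d) powr sdim / a)"
    by (cases "Y = {}")
      (auto simp: centred_premeasure_def[of _ "{}"] centred_premeasure_eq_SUP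
        intro!: SUP_least centred_inf_le[OF _ _ x d _ a])
qed

text \<open>A cell lies within \<open>(1/2) ^ k\<close> of its corner, so a cell with corner in the
  shrunken ball is contained in \<open>cball x d\<close>. The \<open>mu k\<close> measure of the
  shrunken ball is thus at most the fraction \<open>a\<close> of cells inside
  \<open>cball x d\<close>.\<close>

lemma centred_hausdorff_le_C_sup:
  assumes k: "k \<ge> 4" and adm: "(x, d) \<in> admissible k"
  shows "centred_hausdorff sdim gasket \<le> ennreal (C_sup k x d)"
proof -
  define r where "r = d - (1/2) ^ k"
  have x: "x \<in> approx k" "x \<in> cell [0, 1]" and d: "sqrt 3 / 16 \<le> d"
    using adm by (auto simp: admissible_def)
  \<comment> \<open>As \<open>(1/2) ^ k\<close> is at most \<open>1/16\<close>, the shrunken ball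
    still contains its centre \<open>x\<close>, itself a corner, and has positive measure.\<close>
  have "(1/2 :: real) ^ k \<le> (1/2) ^ 4" using k by (intro power_decreasing) auto
  moreover have "(1/2 :: real) ^ 4 = 1/16" by (simp add: power_one_over)
  ultimately have r: "0 \<le> r" "0 < d" using d sqrt3_bounds unfolding r_def by linarith+
  have xg: "x \<in> gasket" using x(2) cell_subset_gasket[of "[0, 1]" 2] by (auto simp: words_def)
  define a where "a = card {u \<in> words k. cell u \<subseteq> cball x d} / 3 ^ k"
  have m: "measure (mu k) (cball x r) = card {w \<in> words k. corner w \<in> cball x r} / 3 ^ k"
    using k by (intro measure_mu) auto
  have "{w \<in> words k. corner w \<in> cball x r} \<subseteq> {u \<in> words k. cell u \<subseteq> cball x d}"
  proof safe
    fix w y assume w: "w \<in> words k" "corner w \<in> cball x r" "y \<in> cell w"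
    have "dist x y \<le> dist x (corner w) + dist (corner w) y" by (rule dist_triangle)
    also have "\<dots> \<le> r + (1/2) ^ k"
      using w dist_corner_cell_le[OF w(1) _ w(3)] k by (intro add_mono) auto
    finally show "y \<in> cball x d" by (simp add: r_def)
  qed
  then have m_le: "measure (mu k) (cball x r) \<le> a"
    unfolding m a_def using finite_words by (intro divide_right_mono of_nat_mono card_mono) auto
  obtain w where "w \<in> words k" "x = corner w" using x(1) approx_eq_corners[of k] k by auto
  then have "{w \<in> words k. corner w \<in> cball x r} \<noteq> {}" using r by auto
  then have m_pos: "0 < measure (mu k) (cball x r)"
    unfolding m using finite_words by (simp add: card_gt_0_iff)
  have "centred_hausdorff sdim gasket \<le> ennreal ((2 * d) powr sdim / a)"
    using m_pos m_le by (intro centred_hausdorff_le[OF xg r(2) a_def]) auto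
  also have "\<dots> \<le> ennreal (C_sup k x d)"
  proof (rule ennreal_leI)
    have "2 powi (- int k) = (1/2 :: real) ^ k" using two_powi_diff[of 0 k] by simp
    then show "(2 * d) powr sdim / a \<le> C_sup k x d"
      unfolding C_sup_def using m_le m_pos by (simp add: divide_left_mono flip: r_def)
  qed
  finally show ?thesis .
qed

theorem theorem10:
  fixes k :: nat
  assumes "k \<ge> 4"
  shows "ennreal (C_inf k) \<le> centred_hausdorff sdim gasket
    \<and> (\<forall>(x, d) \<in> admissible k. inverse (theta (mu k) sdim x d) = C k
         \<longrightarrow> centred_hausdorff sdim gasket \<le> ennreal (C_sup k x d))"
proof (intro conjI)
  show "ennreal (C_inf k) \<le> centred_hausdorff sdim gasket"
    using assms by (rule C_inf_le_centred_hausdorff)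
  show "\<forall>(x, d) \<in> admissible k. inverse (theta (mu k) sdim x d) = C k
         \<longrightarrow> centred_hausdorff sdim gasket \<le> ennreal (C_sup k x d)"
    using centred_hausdorff_le_C_sup[OF assms] by auto
qed

end
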